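(* Let $\omega$ be a weight and let $\varphi$ be an analytic self-map of $\mathbb{D}$. Then $C_{\varphi}:\mathcal{H}_{\omega}\to\mathcal{H}_{\omega}$ is Hilbert-Schmidt if and only if $$\int_{\mathbb{D}}\|R_z\|^2\, N_{\varphi,\omega}(z)\,dA(z)<\infty,$$ where $R_z$ is the reproducing kernel at $z$ of the weighted Bergman space $\mathcal{A}^2_{\omega}$ and $\|R_z\|$ is its norm in $\mathcal{A}^2_\omega$.
   Context: $\mathbb{D}$ is the open unit disk in $\mathbb{C}$, $H(\mathbb{D})$ is the space of analytic functions on $\mathbb{D}$, and $dA$ is the normalized area measure on $\mathbb{D}$. A weight is a positive integrable function $\omega\in C^2[0,1)$, extended radially to $\mathbb{D}$ by $\omega(z)=\omega(|z|)$. $\mathcal{H}_{\omega}$ is the Hilbert space of all $f\in H(\mathbb{D})$ with $\int_{\mathbb{D}}|f'(z)|^2\omega(z)\,dA(z)<\infty$, with norm $\|f\|_{\mathcal{H}_\omega}^2=|f(0)|^2+\int_{\mathbb{D}}|f'(z)|^2\omega(z)\,dA(z)$. The weighted Bergman space $\mathcal{A}^2_\omega$ is the Hilbert space of all $f\in H(\mathbb{D})$ with $\|f\|_{\omega}^2=\int_{\mathbb{D}}|f(z)|^2\omega(z)\,dA(z)<\infty$. Its reproducing kernel $R_z\in\mathcal{A}^2_\omega$ satisfies $f(z)=\int_{\mathbb{D}}f\,\overline{R_z}\,\omega\,dA$ for all $f\in\mathcal{A}^2_\omega$. For an analytic map $\varphi:\mathbb{D}\to\mathbb{D}$, the composition operator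 is $C_\varphi f=f\circ\varphi$, and the generalized Nevanlinna counting function is $N_{\varphi,\omega}(z)=\sum_{a:\,\varphi(a)=z}\omega(a)$ for $z\in\mathbb{D}\setminus\{\varphi(0)\}$ (an empty sum is $0$). *)

theory Defs
  imports "HOL-Analysis.Analysis"
begin

abbreviation unit_disk :: "complex set"  (\<open>\<D>\<close>)
  where "\<D> \<equiv> ball 0 1"

text \<open>Normalized area measure \<open>dA = dx dy / \<pi>\<close>. It lives on the space \<open>\<D>\<close>,
  so the values of integrands outside the disk are irrelevant.\<close>

definition area :: "complex measure" where
  "area = density (restrict_space lborel \<D>) (\<lambda>_. ennreal (1 / pi))"

text \<open>A weight is only constrained on \<open>[0,1)\<close>; derivatives at \<open>0\<close> are one-sided.
  Its radial extension to \<open>\<D>\<close> is written \<open>\<omega> (norm z)\<close>.\<close>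

definition C2_on :: "real set \<Rightarrow> (real \<Rightarrow> real) \<Rightarrow> bool" where
  "C2_on S f \<longleftrightarrow> (\<exists>f' f''.
     (\<forall>x\<in>S. (f has_real_derivative f' x) (at x within S)) \<and>
     (\<forall>x\<in>S. (f' has_real_derivative f'' x) (at x within S)) \<and>
     continuous_on S f'')"

definition weight :: "(real \<Rightarrow> real) \<Rightarrow> bool" where
  "weight \<omega> \<longleftrightarrow>
     (\<forall>r\<in>{0..<1}. 0 < \<omega> r) \<and> set_integrable lborel {0..<1} \<omega> \<and> C2_on {0..<1} \<omega>"


subsection \<open>Operators on Hilbert spaces of functions\<close>

text \<open>A Hilbert space of functions is given by its carrier \<open>H\<close>, with pointwise operations,
  and its inner product \<open>ip\<close> (linear in the first argument).\<close>

type_synonym 'x cfun = "'x \<Rightarrow> complex"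

definition ip_norm :: "('x cfun \<Rightarrow> 'x cfun \<Rightarrow> complex) \<Rightarrow> 'x cfun \<Rightarrow> real" where
  "ip_norm ip f = sqrt (Re (ip f f))"

definition bounded_operator_on ::
  "'x cfun set \<Rightarrow> ('x cfun \<Rightarrow> 'x cfun \<Rightarrow> complex) \<Rightarrow> ('x cfun \<Rightarrow> 'x cfun) \<Rightarrow> bool" where
  "bounded_operator_on H ip T \<longleftrightarrow>
     (\<forall>f\<in>H. T f \<in> H) \<and>
     (\<forall>f\<in>H. \<forall>g\<in>H. T (\<lambda>x. f x + g x) = (\<lambda>x. T f x + T g x)) \<and>
     (\<forall>c. \<forall>f\<in>H. T (\<lambda>x. c * f x) = (\<lambda>x. c * T f x)) \<and>
     (\<exists>K. \<forall>f\<in>H. ip_norm ip (T f) \<le> K * ip_norm ip f)"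

text \<open>An orthonormal basis is a maximal orthonormal subset.\<close>

definition orthonormal_basis_on ::
  "'x cfun set \<Rightarrow> ('x cfun \<Rightarrow> 'x cfun \<Rightarrow> complex) \<Rightarrow> 'x cfun set \<Rightarrow> bool" where
  "orthonormal_basis_on H ip E \<longleftrightarrow>
     E \<subseteq> H \<and>
     (\<forall>e\<in>E. \<forall>e'\<in>E. ip e e' = (if e = e' then 1 else 0)) \<and>
     (\<forall>f\<in>H. (\<forall>e\<in>E. ip f e = 0) \<longrightarrow> f = (\<lambda>_. 0))"

definition hilbert_schmidt_on ::
  "'x cfun set \<Rightarrow> ('x cfun \<Rightarrow> 'x cfun \<Rightarrow> complex) \<Rightarrow> ('x cfun \<Rightarrow> 'x cfun) \<Rightarrow> bool" where
  "hilbert_schmidt_on H ip T \<longleftrightarrow>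
     bounded_operator_on H ip T \<and>
     (\<exists>E. orthonormal_basis_on H ip E \<and> (\<lambda>e. (ip_norm ip (T e))\<^sup>2) summable_on E)"


subsection \<open>The function spaces\<close>

text \<open>Functions on \<open>\<D>\<close> are represented by their extension by \<open>0\<close> to the whole plane, so that
  equality in the spaces below is equality on \<open>\<D>\<close>.\<close>

definition analytic_disk :: "complex cfun set" where
  "analytic_disk = {f. f holomorphic_on \<D> \<and> (\<forall>z. z \<notin> \<D> \<longrightarrow> f z = 0)}"

definition hspace :: "(real \<Rightarrow> real) \<Rightarrow> complex cfun set" where
  "hspace \<omega> = {f \<in> analytic_disk. integrable area (\<lambda>z. (norm (deriv f z))\<^sup>2 * \<omega> (norm z))}"

definition hspace_inner :: "(real \<Rightarrow> real) \<Rightarrow> complex cfun \<Rightarrow> complex cfun \<Rightarrow> complex" where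
  "hspace_inner \<omega> f g =
     f 0 * cnj (g 0) + (LINT z|area. deriv f z * cnj (deriv g z) * of_real (\<omega> (norm z)))"

lemma hspace_norm:
  "ip_norm (hspace_inner \<omega>) f =
     sqrt ((norm (f 0))\<^sup>2 + (LINT z|area. (norm (deriv f z))\<^sup>2 * \<omega> (norm z)))"
proof -
  have "(LINT z|area. deriv f z * cnj (deriv f z) * of_real (\<omega> (norm z))) =
        of_real (LINT z|area. (norm (deriv f z))\<^sup>2 * \<omega> (norm z))"
    by (subst integral_complex_of_real [symmetric])
       (simp add: complex_norm_square [symmetric] flip: of_real_power of_real_mult)
  then show ?thesis
    by (simp add: ip_norm_def hspace_inner_def complex_norm_square [symmetric]
             flip: of_real_power)
qed

definition bergman :: "(real \<Rightarrow> real) \<Rightarrow> complex cfun set" where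
  "bergman \<omega> = {f \<in> analytic_disk. integrable area (\<lambda>z. (norm (f z))\<^sup>2 * \<omega> (norm z))}"

definition bergman_norm :: "(real \<Rightarrow> real) \<Rightarrow> complex cfun \<Rightarrow> real" where
  "bergman_norm \<omega> f = sqrt (LINT z|area. (norm (f z))\<^sup>2 * \<omega> (norm z))"

definition bergman_kernel :: "(real \<Rightarrow> real) \<Rightarrow> complex \<Rightarrow> complex cfun" where
  "bergman_kernel \<omega> z = (THE R. R \<in> bergman \<omega> \<and>
     (\<forall>f\<in>bergman \<omega>. f z = (LINT w|area. f w * cnj (R w) * of_real (\<omega> (norm w)))))"


subsection \<open>Composition operators\<close>

definition comp_op :: "(complex \<Rightarrow> complex) \<Rightarrow> complex cfun \<Rightarrow> complex cfun" where
  "comp_op \<phi> f = (\<lambda>z. if z \<in> \<D> then f (\<phi> z) else 0)"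

text \<open>The sum may be infinite, hence the values in \<open>ennreal\<close>. Usually this function is left
  undefined at \<open>\<phi> 0\<close>; here the formula is used there too, which does not affect integrals
  with respect to \<^const>\<open>area\<close>.\<close>

definition nevanlinna :: "(complex \<Rightarrow> complex) \<Rightarrow> (real \<Rightarrow> real) \<Rightarrow> complex \<Rightarrow> ennreal" where
  "nevanlinna \<phi> \<omega> z = (\<Sum>\<^sub>\<infinity>a\<in>{a \<in> \<D>. \<phi> a = z}. ennreal (\<omega> (norm a)))"

end

theory Submission
  imports Defs "HOL-Complex_Analysis.Complex_Analysis"
begin

text \<open>
  Write \<open>H\<^sub>\<omega>\<close> for \<^term>\<open>hspace \<omega>\<close>, \<open>A\<^sup>2\<^sub>\<omega>\<close> for \<^term>\<open>bergman \<omega>\<close> and \<open>R\<^sub>z\<close> for the reproducing kernel of \<open>A\<^sup>2\<^sub>\<omega>\<close>.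
  The map \<open>f \<mapsto> (f 0, f')\<close> is an isometry of \<open>H\<^sub>\<omega>\<close> onto the orthogonal sum of \<open>\<complex>\<close> and \<open>A\<^sup>2\<^sub>\<omega>\<close>. Hence
  the functional \<open>f \<mapsto> f' z\<close> on \<open>H\<^sub>\<omega>\<close> is represented by a primitive of \<open>R\<^sub>z\<close> of the same norm, and Parseval's
  identity gives, for every orthonormal basis \<open>E\<close> of \<open>H\<^sub>\<omega>\<close>,
  \<open>\<Sum>e\<in>E. \<bar>e' z\<bar>\<^sup>2 = \<parallel>R\<^sub>z\<parallel>\<^sup>2\<close> (lemma \<open>basis_derivative_has_sum\<close>).

  On the other hand \<open>\<parallel>e \<circ> \<phi>\<parallel>\<^sup>2 = \<bar>e (\<phi> 0)\<bar>\<^sup>2 + \<integral> \<bar>e' \<circ> \<phi>\<bar>\<^sup>2 \<bar>\<phi>'\<bar>\<^sup>2 \<omega> dA\<close>. The first terms have a finite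
  sum over \<open>E\<close>, because evaluation at \<open>\<phi> 0\<close> is a bounded functional. So, with \<open>K z = \<parallel>R\<^sub>z\<parallel>\<^sup>2\<close>, the
  Hilbert-Schmidt sum is finite exactly when \<open>\<integral> K (\<phi> z) \<bar>\<phi>' z\<bar>\<^sup>2 \<omega> \<bar>z\<bar> dA(z)\<close> is. The change of variables
  \<open>w = \<phi> z\<close>, which counts every \<open>w\<close> with the weights of all its preimages, turns this integral into
  the one with the counting function (\<open>nn_integral_area_formula\<close>, \<open>kernel_energy_eq_nevanlinna\<close>).
  Finiteness of the integral also implies that \<open>C\<^sub>\<phi>\<close> is bounded, because \<open>\<bar>f' z\<bar> \<le> \<parallel>f\<parallel> \<parallel>R\<^sub>z\<parallel>\<close>.

  The work behind this is the area formula for non-injective holomorphic maps, the theorems of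
  Riesz-Fischer, Parseval and Riesz for Hilbert spaces of functions with bases of arbitrary
  cardinality, and the completeness of \<open>A\<^sup>2\<^sub>\<omega>\<close>, which rests on a local bound of \<open>\<bar>f z\<bar>\<close> by the norm
  (\<open>bergman_point_bound\<close>).
\<close>

section \<open>Change of variables for injective holomorphic maps\<close>

definition to_complex :: "real^2 \<Rightarrow> complex" where "to_complex v = Complex (v$1) (v$2)"
definition to_vec :: "complex \<Rightarrow> real^2" where "to_vec z = (\<chi> i. if i = 1 then Re z else Im z)"

lemma to_vec_nth [simp]: "to_vec z $ 1 = Re z" "to_vec z $ 2 = Im z"
  by (auto simp: to_vec_def)

lemma to_complex_to_vec [simp]: "to_complex (to_vec z) = z"
  by (simp add: to_complex_def)

lemma to_vec_to_complex [simp]: "to_vec (to_complex v) = v"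
  by (simp add: vec_eq_iff forall_2 to_complex_def)

lemma bounded_linear_to_complex: "bounded_linear to_complex"
  unfolding linear_conv_bounded_linear[symmetric] to_complex_def
  by (rule linearI) (auto simp: complex_eq_iff)

lemma bounded_linear_to_vec: "bounded_linear to_vec"
  unfolding linear_conv_bounded_linear[symmetric]
  by (rule linearI) (auto simp: vec_eq_iff forall_2)

lemma measurable_to_complex [measurable]: "to_complex \<in> borel_measurable borel"
  using bounded_linear_to_complex
  by (intro borel_measurable_continuous_onI linear_continuous_on)

lemma lborel_distr_to_complex: "distr lborel borel to_complex = lborel"
proof (rule sym, rule lborel_eqI)
  fix l u :: complex assume le: "\<And>b. b \<in> Basis \<Longrightarrow> l \<bullet> b \<le> u \<bullet> b"
  have eq: "to_complex -` box l u = box (to_vec l) (to_vec u)"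
    by (auto simp: set_eq_iff mem_box_cart forall_2 to_complex_def in_box_complex_iff)
  have le': "Re l \<le> Re u" "Im l \<le> Im u"
    using le[of 1] le[of \<i>] by (auto simp: Basis_complex_def)
  have le2: "\<forall>b\<in>Basis. to_vec l \<bullet> b \<le> to_vec u \<bullet> b"
    using le' by (auto simp: Basis_vec_def inner_axis forall_2)
  have "emeasure (distr lborel borel to_complex) (box l u) = emeasure lborel (box (to_vec l) (to_vec u))"
    by (subst emeasure_distr) (auto simp: eq)
  also have "\<dots> = (\<Prod>b\<in>Basis. (to_vec u - to_vec l) \<bullet> b)"
    using le2 by (intro emeasure_lborel_box) auto
  also have "(\<Prod>b\<in>Basis. (to_vec u - to_vec l) \<bullet> b) = (Re u - Re l) * (Im u - Im l)"
  proof -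
    have B: "(Basis :: (real^2) set) = {axis 1 1, axis 2 1}"
      by (auto simp: Basis_vec_def) (metis (full_types) exhaust_2)
    show ?thesis by (simp add: B inner_axis axis_eq_axis)
  qed
  also have "(Re u - Re l) * (Im u - Im l) = (\<Prod>b\<in>Basis. (u - l) \<bullet> b)"
    by (simp add: Basis_complex_def)
  finally show "emeasure (distr lborel borel to_complex) (box l u) = (\<Prod>b\<in>Basis. (u - l) \<bullet> b)" .
qed simp

lemma det_matrix_mult_complex:
  "det (matrix (\<lambda>h. to_vec (c * to_complex h))) = (norm c)\<^sup>2"
  unfolding cmod_power2
  by (simp add: det_2 matrix_def axis_def to_complex_def power2_eq_square)

text \<open>
  The real derivative of a holomorphic \<open>f\<close> is multiplication by the complex derivative, whose
  determinant is the square of its modulus. Transported along the measure preserving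
  isomorphism between \<open>\<real>\<^sup>2\<close> and \<open>\<complex>\<close>, this turns the real change of variables theorem into
  the area formula for injective holomorphic maps.
\<close>

lemma emeasure_holomorphic_image:
  assumes hol: "f holomorphic_on U" and U: "open U" and inj: "inj_on f U"
    and S: "S \<in> sets borel" "S \<subseteq> U"
  shows "f ` S \<in> sets borel"
    and "emeasure lborel (f ` S) = (\<integral>\<^sup>+z. ennreal ((norm (deriv f z))\<^sup>2) * indicator S z \<partial>lborel)"
proof -
  obtain g where g: "g holomorphic_on (f ` U)" "\<And>z. z \<in> U \<Longrightarrow> g (f z) = z"
    using holomorphic_has_inverse[OF hol U inj] by metis
  have oU: "open (f ` U)"
    by (rule open_mapping_thm3[OF hol U inj])
  \<comment> \<open>The image is the preimage of \<open>S\<close> under the continuous inverse of \<open>f\<close>, hence Borel.\<close>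
  have "f ` S = f ` U \<inter> g -` S" using g(2) S(2) by auto
  moreover have "f ` U \<inter> g -` S \<in> sets borel"
  proof -
    have "g \<in> borel_measurable (restrict_space borel (f ` U))"
      by (intro borel_measurable_continuous_on_restrict holomorphic_on_imp_continuous_on g)
    from measurable_sets[OF this S(1)] show ?thesis
      using oU by (auto simp: sets_restrict_space_iff space_restrict_space Int_commute)
  qed
  ultimately show fS: "f ` S \<in> sets borel" by simp
  define S' where "S' = to_vec ` S"
  have S'_eq: "S' = to_complex -` S"
    unfolding S'_def by (auto simp: image_iff) (metis to_vec_to_complex)
  have S'b: "S' \<in> sets borel"
    unfolding S'_eq using measurable_sets[OF measurable_to_complex S(1)] by simp
  define F where "F = (\<lambda>v. to_vec (f (to_complex v)))"
  define F' where "F' = (\<lambda>v h. to_vec (deriv f (to_complex v) * to_complex h))"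
  have F_S': "F ` S' = to_complex -` (f ` S)"
  proof (intro equalityI subsetI)
    fix x assume "x \<in> to_complex -` (f ` S)"
    then obtain z where "z \<in> S" "to_complex x = f z" by auto
    then have "x = F (to_vec z)" "to_vec z \<in> S'"
      by (auto simp: F_def S'_def) (metis to_vec_to_complex)
    then show "x \<in> F ` S'" by blast
  qed (auto simp: F_def S'_def)
  have F_S'b: "F ` S' \<in> sets borel"
    unfolding F_S' using measurable_sets[OF measurable_to_complex fS] by simp
  have der: "(F has_derivative F' v) (at v within S')" if "v \<in> S'" for v
  proof -
    have "to_complex v \<in> U" using that S(2) S'_eq by auto
    then have "(f has_field_derivative deriv f (to_complex v)) (at (to_complex v))"
      using hol U holomorphic_derivI by blast
    then have 1: "(f has_derivative (*) (deriv f (to_complex v))) (at (to_complex v))"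
      by (simp add: has_field_derivative_def)
    have "(F has_derivative F' v) (at v)"
      unfolding F_def F'_def
      by (intro bounded_linear.has_derivative[OF bounded_linear_to_vec]
          has_derivative_compose[OF bounded_linear_imp_has_derivative[OF bounded_linear_to_complex] 1])
    then show ?thesis by (rule has_derivative_at_withinI)
  qed
  have injF: "inj_on F S'"
    using inj S(2) unfolding F_def S'_eq
    by (auto simp: inj_on_def) (metis subsetD to_complex_to_vec to_vec_to_complex)
  have S'l: "S' \<in> sets lebesgue" using S'b by (simp add: borel_measurable_if_D)
  define J where "J = (\<lambda>v. (norm (deriv f (to_complex v)))\<^sup>2)"
  have J: "\<bar>det (matrix (F' v))\<bar> = J v" for v
    unfolding F'_def J_def by (simp add: det_matrix_mult_complex)
  \<comment> \<open>This equivalence also covers images of infinite measure, by contraposition.\<close>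
  have hm: "F ` S' \<in> lmeasurable \<and> measure lebesgue (F ` S') = m \<longleftrightarrow> (J has_integral m) S'" for m
    using has_measure_differentiable_image[OF S'l der injF, of m] by (simp add: J)
  have eq1: "emeasure lborel (F ` S') = emeasure lborel (f ` S)"
  proof -
    have "emeasure lborel (f ` S) = emeasure (distr lborel borel to_complex) (f ` S)"
      by (simp add: lborel_distr_to_complex)
    also have "\<dots> = emeasure lborel (F ` S')"
      using fS by (subst emeasure_distr) (auto simp: F_S')
    finally show ?thesis by simp
  qed
  have contd: "continuous_on U (deriv f)"
    by (intro holomorphic_on_imp_continuous_on holomorphic_deriv hol U)
  have df: "(\<lambda>z. ennreal ((norm (deriv f z))\<^sup>2) * indicator S z) \<in> borel_measurable borel"
  proof -
    have "(\<lambda>z. ennreal ((norm (deriv f z))\<^sup>2)) \<in> borel_measurable (restrict_space borel S)"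
      by (intro measurable_compose[OF _ measurable_ennreal] borel_measurable_continuous_on_restrict
          continuous_intros continuous_on_subset[OF contd S(2)])
    then show ?thesis using S by (subst (asm) borel_measurable_restrict_space_iff_ennreal) auto
  qed
  have eq2: "(\<integral>\<^sup>+z. ennreal ((norm (deriv f z))\<^sup>2) * indicator S z \<partial>lborel)
      = (\<integral>\<^sup>+v. ennreal (J v * indicator S' v) \<partial>lborel)"
    unfolding lborel_distr_to_complex[symmetric]
    by (subst nn_integral_distr) (use df in \<open>auto simp: J_def S'_eq indicator_def intro!: nn_integral_cong\<close>)
  have J0: "J v * indicator S' v \<ge> 0" for v by (simp add: J_def)
  have Jm: "(\<lambda>v. J v * indicator S' v) \<in> borel_measurable borel"
  proof -
    have "(\<lambda>v. enn2real ((\<lambda>z. ennreal ((norm (deriv f z))\<^sup>2) * indicator S z) (to_complex v))) \<in> borel_measurable borel"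
      using df by measurable
    also have "(\<lambda>v. enn2real ((\<lambda>z. ennreal ((norm (deriv f z))\<^sup>2) * indicator S z) (to_complex v))) 
       = (\<lambda>v. J v * indicator S' v)"
      by (auto simp: J_def S'_eq indicator_def)
    finally show ?thesis .
  qed
  have Jint: "(J has_integral m) S' \<longleftrightarrow> ((\<lambda>v. J v * indicator S' v) has_integral m) UNIV" for m
    by (subst has_integral_restrict_UNIV[symmetric]) (simp add: indicator_def of_bool_def if_distrib cong: if_cong)
  show "emeasure lborel (f ` S) = (\<integral>\<^sup>+z. ennreal ((norm (deriv f z))\<^sup>2) * indicator S z \<partial>lborel)"
  proof (cases "emeasure lborel (F ` S') < \<infinity>")
    case True
    then have lm: "F ` S' \<in> lmeasurable" using F_S'b by (auto simp: fmeasurable_def)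
    then have "((\<lambda>v. J v * indicator S' v) has_integral (measure lebesgue (F ` S'))) UNIV"
      using hm Jint by blast
    from nn_integral_has_integral_lborel[OF Jm J0 this]
    have "(\<integral>\<^sup>+v. ennreal (J v * indicator S' v) \<partial>lborel) = ennreal (measure lebesgue (F ` S'))" .
    also have "\<dots> = emeasure lborel (F ` S')"
      using lm F_S'b emeasure_eq_measure2[OF lm] by simp
    finally show ?thesis using eq1 eq2 by simp
  next
    case False
    have "(\<integral>\<^sup>+v. ennreal (J v * indicator S' v) \<partial>lborel) = \<infinity>"
    proof (rule ccontr)
      assume "\<not> ?thesis"
      then have "(\<integral>\<^sup>+v. ennreal (J v * indicator S' v) \<partial>lborel) < \<infinity>" by (simp add: less_top)
      from nn_integral_integrable_on[OF Jm J0 this] obtain m where "(J has_integral m) S'"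
        using Jint by (auto simp: integrable_on_def)
      with hm have "F ` S' \<in> lmeasurable" by blast
      then have "emeasure lborel (F ` S') < \<infinity>"
        using F_S'b by (auto simp: fmeasurable_def)
      with False show False by simp
    qed
    then show ?thesis using False eq1 eq2 by (simp flip: less_top)
  qed
qed

text \<open>
  The preceding lemma says that the measure with density \<open>\<bar>f'\<bar>\<^sup>2\<close> on \<open>U\<close> is the image, under the
  inverse map \<open>g\<close>, of Lebesgue measure on \<open>f ` U\<close>. Integrating with respect to both measures gives
  the substitution rule for every non-negative measurable integrand, finite or not.
\<close>

lemma nn_integral_holomorphic_substitution:
  assumes hol: "f holomorphic_on U" and U: "open U" and inj: "inj_on f U"
    and g: "\<And>z. z \<in> U \<Longrightarrow> g (f z) = z"
    and F: "F \<in> borel_measurable (restrict_space borel U)"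
  shows "(\<lambda>w. F (g w)) \<in> borel_measurable (restrict_space borel (f ` U))" (is ?meas)
    and "(\<integral>\<^sup>+z\<in>U. F z * ennreal ((norm (deriv f z))\<^sup>2) \<partial>lborel) = (\<integral>\<^sup>+w\<in>f ` U. F (g w) \<partial>lborel)"
proof -
  have oU: "open (f ` U)"
    by (rule open_mapping_thm3[OF hol U inj])
  have gcont: "continuous_on (f ` U) g"
  proof -
    obtain g' where g': "g' holomorphic_on (f ` U)" "\<And>z. z \<in> U \<Longrightarrow> g' (f z) = z"
      using holomorphic_has_inverse[OF hol U inj] by metis
    show ?thesis
      by (rule continuous_on_eq[OF holomorphic_on_imp_continuous_on[OF g'(1)]]) (auto simp: g g')
  qed
  have gm: "g \<in> restrict_space borel (f ` U) \<rightarrow>\<^sub>M restrict_space borel U"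
    by (rule measurable_restrict_space2)
      (use g in \<open>auto simp: space_restrict_space intro!: borel_measurable_continuous_on_restrict gcont\<close>)
  show ?meas using measurable_compose[OF gm F] .
  have gm': "g \<in> restrict_space lborel (f ` U) \<rightarrow>\<^sub>M restrict_space borel U"
    using gm by (simp cong: measurable_cong_sets add: sets_restrict_space)
  have dm: "(\<lambda>z. ennreal ((norm (deriv f z))\<^sup>2)) \<in> borel_measurable (restrict_space lborel U)"
  proof -
    have "(\<lambda>z. ennreal ((norm (deriv f z))\<^sup>2)) \<in> borel_measurable (restrict_space borel U)"
      by (intro measurable_compose[OF _ measurable_ennreal] borel_measurable_continuous_on_restrict
          continuous_intros holomorphic_on_imp_continuous_on holomorphic_deriv hol U)
    then show ?thesis by (simp cong: measurable_cong_sets add: sets_restrict_space)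
  qed
  have meq: "density (restrict_space lborel U) (\<lambda>z. ennreal ((norm (deriv f z))\<^sup>2))
    = distr (restrict_space lborel (f ` U)) (restrict_space borel U) g" (is "?M1 = ?M2")
  proof (rule measure_eqI)
    show "sets ?M1 = sets ?M2" by (simp add: sets_restrict_space)
    fix X assume "X \<in> sets ?M1"
    then have X: "X \<in> sets borel" "X \<subseteq> U" and X': "X \<in> sets (restrict_space lborel U)"
      "X \<in> sets (restrict_space borel U)"
      using U by (auto simp: sets_restrict_space_iff sets_restrict_space)
    have "emeasure ?M1 X = (\<integral>\<^sup>+z. ennreal ((norm (deriv f z))\<^sup>2) * indicator X z \<partial>restrict_space lborel U)"
      by (rule emeasure_density[OF dm X'(1)])
    also have "\<dots> = (\<integral>\<^sup>+z. ennreal ((norm (deriv f z))\<^sup>2) * indicator X z * indicator U z \<partial>lborel)"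
      by (rule nn_integral_restrict_space) (use U in auto)
    also have "\<dots> = (\<integral>\<^sup>+z. ennreal ((norm (deriv f z))\<^sup>2) * indicator X z \<partial>lborel)"
      by (intro nn_integral_cong) (use X(2) in \<open>auto simp: indicator_def\<close>)
    also have "\<dots> = emeasure lborel (f ` X)"
      by (rule emeasure_holomorphic_image(2)[OF hol U inj X, symmetric])
    also have "f ` X = g -` X \<inter> space (restrict_space lborel (f ` U))"
      using X g by (auto simp: space_restrict_space)
    also have "emeasure lborel \<dots> = emeasure (restrict_space lborel (f ` U)) \<dots>"
      by (rule emeasure_restrict_space[symmetric]) (use oU in \<open>auto simp: space_restrict_space\<close>)
    also have "\<dots> = emeasure ?M2 X"
      by (rule emeasure_distr[OF gm' X'(2), symmetric])
    finally show "emeasure ?M1 X = emeasure ?M2 X" .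
  qed
  have F': "F \<in> borel_measurable (restrict_space lborel U)"
    using F by (simp cong: measurable_cong_sets add: sets_restrict_space)
  have "(\<integral>\<^sup>+z\<in>U. F z * ennreal ((norm (deriv f z))\<^sup>2) \<partial>lborel) =
      (\<integral>\<^sup>+z. ennreal ((norm (deriv f z))\<^sup>2) * F z \<partial>restrict_space lborel U)"
    by (subst nn_integral_restrict_space) (use U in \<open>auto simp: mult_ac\<close>)
  also have "\<dots> = (\<integral>\<^sup>+z. F z \<partial>?M1)"
    by (rule nn_integral_density[OF dm F', symmetric])
  also have "\<dots> = (\<integral>\<^sup>+w. F (g w) \<partial>restrict_space lborel (f ` U))"
    unfolding meq by (rule nn_integral_distr[OF gm']) (use F in simp)
  also have "\<dots> = (\<integral>\<^sup>+w\<in>f ` U. F (g w) \<partial>lborel)"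
    by (subst nn_integral_restrict_space) (use oU in auto)
  finally show "(\<integral>\<^sup>+z\<in>U. F z * ennreal ((norm (deriv f z))\<^sup>2) \<partial>lborel) = (\<integral>\<^sup>+w\<in>f ` U. F (g w) \<partial>lborel)" .
qed

section \<open>The area formula with multiplicities\<close>

text \<open>
  An open set is exhausted by the closed sets of points at distance at least \<open>1 / n\<close> from the
  complement. This feeds the theorem that zero sets of holomorphic functions are countable.
\<close>

lemma open_imp_fsigma:
  fixes U :: "complex set"
  assumes "open U"
  shows "fsigma U"
proof (cases "U = UNIV")
  case False
  define F where "F = (\<lambda>n::nat. {x. 1 / real (Suc n) \<le> infdist x (- U)})"
  have "closed (F n)" for n
    unfolding F_def by (intro closed_Collect_le continuous_intros)
  moreover have "(\<Union>n. F n) = U"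
  proof (intro equalityI subsetI)
    fix x assume "x \<in> (\<Union>n. F n)"
    then obtain n where "1 / real (Suc n) \<le> infdist x (- U)" by (auto simp: F_def)
    then have "infdist x (- U) > 0" by (smt (verit) of_nat_0_less_iff zero_less_Suc zero_less_divide_1_iff)
    then show "x \<in> U" by (metis ComplI infdist_zero less_irrefl)
  next
    fix x assume "x \<in> U"
    then have "infdist x (- U) > 0"
      using False assms by (intro infdist_pos_not_in_closed) auto
    then obtain n where "inverse (real (Suc n)) < infdist x (- U)" using reals_Archimedean by blast
    then have "x \<in> F n" by (simp add: F_def inverse_eq_divide)
    then show "x \<in> (\<Union>n. F n)" by blast
  qed
  ultimately show ?thesis using fsigma.intros[of F] by simp
qed simp

text \<open>
  The critical points are isolated unless \<open>f\<close> is constant, and in that case there is only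
  one critical value. Speaking of critical values rather than critical points lets both cases be
  treated as one below.
\<close>

lemma countable_critical_values:
  assumes hol: "f holomorphic_on U" and U: "open U" "connected U"
  shows "countable (f ` {z\<in>U. deriv f z = 0})"
proof (cases "deriv f constant_on U")
  case True
  then obtain c where c: "\<And>z. z \<in> U \<Longrightarrow> deriv f z = c" by (auto simp: constant_on_def)
  show ?thesis
  proof (cases "c = 0")
    case True
    have "f constant_on U"
      by (rule has_field_derivative_0_imp_constant_on[OF _ U(2,1)])
        (use c True hol U(1) holomorphic_derivI in metis)
    then obtain d where "\<And>z. z \<in> U \<Longrightarrow> f z = d" by (auto simp: constant_on_def)
    then have "f ` {z\<in>U. deriv f z = 0} \<subseteq> {d}" by auto
    then show ?thesis by (rule countable_subset) auto
  next
    case False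
    then have "{z\<in>U. deriv f z = 0} = {}" using c by auto
    then show ?thesis by (metis countable_empty image_empty)
  qed
next
  case False
  have "countable {z\<in>U. deriv f z = 0}"
    by (rule holomorphic_countable_zeros) (use False hol U in \<open>auto intro: holomorphic_deriv open_imp_fsigma\<close>)
  then show ?thesis by simp
qed

text \<open>
  Used with \<open>S\<close> a fibre of \<open>f\<close> and \<open>T i\<close> its part in a region on which \<open>f\<close> is injective.
\<close>

lemma infsum_ennreal_disjoint_singletons:
  fixes W :: "'a \<Rightarrow> ennreal"
  assumes S: "S = (\<Union>i. T i)" and disj: "disjoint_family T"
    and single: "\<And>i x y. x \<in> T i \<Longrightarrow> y \<in> T i \<Longrightarrow> x = y"
  shows "infsum W S = (\<Sum>i::nat. infsum W (T i))"
proof -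
  define I where "I = {i. T i \<noteq> {}}"
  define a where "a = (\<lambda>i. SOME x. x \<in> T i)"
  have a: "a i \<in> T i" if "i \<in> I" for i using that unfolding I_def a_def by (auto intro: someI)
  have T: "T i = {a i}" if "i \<in> I" for i using a[OF that] single by blast
  have bij: "bij_betw a I S"
    unfolding bij_betw_def
  proof
    show "inj_on a I"
      using a disj unfolding inj_on_def disjoint_family_on_def by (metis IntI UNIV_I empty_iff)
    show "a ` I = S"
    proof (intro equalityI subsetI)
      fix x assume "x \<in> S"
      then obtain i where "x \<in> T i" using S by blast
      moreover from this have "i \<in> I" by (auto simp: I_def)
      ultimately show "x \<in> a ` I" using T by blast
    qed (use a S in blast)
  qed
  have "infsum W S = infsum (\<lambda>i. W (a i)) I"
    using infsum_reindex_bij_betw[OF bij, of W] by simp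
  also have "\<dots> = infsum (\<lambda>i. infsum W (T i)) UNIV"
  proof (rule infsum_cong_neutral)
    fix i assume "i \<in> I \<inter> UNIV"
    then show "W (a i) = infsum W (T i)" using T[of i] by simp
  qed (auto simp: I_def)
  also have "\<dots> = (\<Sum>i. infsum W (T i))"
  proof -
    have "((\<lambda>i. infsum W (T i)) has_sum infsum (\<lambda>i. infsum W (T i)) UNIV) UNIV"
      by (intro has_sum_infsum nonneg_summable_on_complete) simp
    then show ?thesis by (intro sums_unique has_sum_imp_sums)
  qed
  finally show ?thesis .
qed

text \<open>
  Away from the critical points, \<open>U\<close> is covered by open sets on which \<open>f\<close> is injective; by
  Lindelof's theorem countably many of them suffice, and they can be made disjoint. On each piece
  the substitution rule applies, and summing over the pieces collects, for each value \<open>w\<close>, the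
  weights of all its preimages. Critical points do not contribute to the left side because the
  derivative vanishes there, nor to the right side because there are only countably many
  critical values.
\<close>

theorem nn_integral_area_formula:
  assumes hol: "f holomorphic_on U" and U: "open U" "connected U"
    and W: "W \<in> borel_measurable (restrict_space borel U)"
    and G: "G \<in> borel_measurable borel"
  shows "(\<lambda>w. \<Sum>\<^sub>\<infinity>a\<in>{a\<in>U. f a = w}. W a) \<in> borel_measurable borel" (is ?meas)
    and "(\<integral>\<^sup>+z\<in>U. G (f z) * W z * ennreal ((norm (deriv f z))\<^sup>2) \<partial>lborel) =
    (\<integral>\<^sup>+w. G w * (\<Sum>\<^sub>\<infinity>a\<in>{a\<in>U. f a = w}. W a) \<partial>lborel)" (is ?eq)
proof -
  define \<F> where "\<F> = {B. open B \<and> B \<subseteq> U \<and> inj_on f B}"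
  obtain \<F>' where \<F>': "\<F>' \<subseteq> \<F>" "countable \<F>'" "\<Union>\<F>' = \<Union>\<F>"
    using Lindelof[of \<F>] unfolding \<F>_def by auto
  \<comment> \<open>The empty set makes the enumeration well defined when the subcover is empty.\<close>
  define B where "B = from_nat_into (insert {} \<F>')"
  have rB: "range B = insert {} \<F>'"
    unfolding B_def using \<F>'(2) by (intro range_from_nat_into) auto
  have "B i \<in> \<F>" for i
  proof -
    have "B i \<in> insert {} \<F>'" using rB by blast
    then show ?thesis using \<F>'(1) by (auto simp: \<F>_def)
  qed
  then have B: "open (B i)" "B i \<subseteq> U" "inj_on f (B i)" for i by (auto simp: \<F>_def)
  have UB: "\<Union>(range B) = \<Union>\<F>" using rB \<F>'(3) by auto
  define A where "A = disjointed B"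
  have AB: "A i \<subseteq> B i" for i unfolding A_def by (rule disjointed_subset)
  have UA: "(\<Union>i. A i) = \<Union>\<F>" unfolding A_def UB[symmetric] by (rule UN_disjointed_eq)
  have Adisj: "disjoint_family A" unfolding A_def by (rule disjoint_family_disjointed)
  have Ab[measurable]: "A i \<in> sets borel" for i
    unfolding A_def disjointed_def using B by auto
  define Z where "Z = U - \<Union>\<F>"
  have Zd: "deriv f z = 0" if "z \<in> Z" for z
  proof (rule ccontr)
    assume "deriv f z \<noteq> 0"
    moreover have "z \<in> U" using that unfolding Z_def by blast
    ultimately obtain r where "r > 0" "ball z r \<subseteq> U" "inj_on f (ball z r)"
      using has_complex_derivative_locally_injective[OF hol _ U(1)] by blast
    then have "ball z r \<in> \<F>" "z \<in> ball z r" by (auto simp: \<F>_def)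
    then show False using that unfolding Z_def by blast
  qed
  have "f ` Z \<subseteq> f ` {z\<in>U. deriv f z = 0}" using Zd Z_def by auto
  then have cfZ: "countable (f ` Z)" using countable_critical_values[OF hol U] countable_subset by blast
  have "\<exists>g. \<forall>i. \<forall>z\<in>B i. g i (f z) = z"
    by (rule exI[of _ "\<lambda>i. the_inv_into (B i) f"]) (use B in \<open>auto intro: the_inv_into_f_f\<close>)
  then obtain g where g: "\<And>i z. z \<in> B i \<Longrightarrow> g i (f z) = z" by blast
  have Wm: "(\<lambda>z. W z * indicator (A i) z) \<in> borel_measurable (restrict_space borel (B i))" for i
  proof -
    have "(\<lambda>z. W z * indicator (A i) z) \<in> borel_measurable (restrict_space borel U)"
      by (intro borel_measurable_times_ennreal W measurable_restrict_space1) measurable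
    from measurable_restrict_space1[OF this, of "B i"] show ?thesis
      using B(2)[of i] B(1)[of i] U(1) by (simp add: restrict_restrict_space Int_absorb1)
  qed
  have fm: "f \<in> borel_measurable (restrict_space borel (B i))" for i
    using hol B(2)[of i] by (intro borel_measurable_continuous_on_restrict holomorphic_on_imp_continuous_on)
      (rule holomorphic_on_subset)
  \<comment> \<open>The contribution of the \<open>i\<close>-th piece to the sum over the fibre of \<open>w\<close>.\<close>
  define h where "h = (\<lambda>i w. (W (g i w) * indicator (A i) (g i w)) * indicator (f ` B i) w)"
  have hm: "h i \<in> borel_measurable borel" for i
  proof -
    have "(\<lambda>w. W (g i w) * indicator (A i) (g i w)) \<in> borel_measurable (restrict_space borel (f ` B i))"
      using nn_integral_holomorphic_substitution(1)[OF holomorphic_on_subset[OF hol B(2)] B(1) B(3) g Wm] .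
    moreover have "open (f ` B i)"
      by (rule open_mapping_thm3[OF holomorphic_on_subset[OF hol B(2)] B(1) B(3)])
    ultimately show ?thesis unfolding h_def
      by (subst (asm) borel_measurable_restrict_space_iff_ennreal) auto
  qed
  have h: "h i w = infsum W {a\<in>A i. f a = w}" for i w
  proof (cases "w \<in> f ` A i")
    case True
    then obtain a where a: "a \<in> A i" "w = f a" by auto
    then have eq: "{a\<in>A i. f a = w} = {a}" using B(3)[of i] AB[of i] by (auto simp: inj_on_def)
    have aB: "a \<in> B i" using a(1) AB[of i] by blast
    have "g i w = a" using g[OF aB] a(2) by simp
    moreover have "w \<in> f ` B i" using aB a(2) by blast
    ultimately have "h i w = W a" using a(1) by (simp add: h_def)
    then show ?thesis unfolding eq by simp
  next
    case False
    then have "{a\<in>A i. f a = w} = {}" by auto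
    moreover have "h i w = 0"
    proof (cases "w \<in> f ` B i")
      case True
      then obtain a where a: "a \<in> B i" "w = f a" by blast
      then have "a \<notin> A i" using False by blast
      then show ?thesis using a g[OF a(1)] by (simp add: h_def)
    qed (simp add: h_def)
    ultimately show ?thesis by (metis infsum_empty)
  qed
  have hsum: "(\<Sum>i. h i w) = infsum W {a\<in>U. f a = w}" if "w \<notin> f ` Z" for w
  proof -
    have 1: "{a\<in>U. f a = w} = (\<Union>i. {a\<in>A i. f a = w})"
    proof (intro equalityI subsetI)
      fix a assume a: "a \<in> {a\<in>U. f a = w}"
      then have "a \<in> (\<Union>i. A i)" using that unfolding UA Z_def by blast
      then show "a \<in> (\<Union>i. {a\<in>A i. f a = w})" using a by blast
    next
      fix a assume "a \<in> (\<Union>i. {a\<in>A i. f a = w})"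
      then obtain i where "a \<in> A i" "f a = w" by blast
      then show "a \<in> {a\<in>U. f a = w}" using AB[of i] B(2)[of i] by blast
    qed
    have 2: "disjoint_family (\<lambda>i. {a\<in>A i. f a = w})"
      using Adisj by (auto simp: disjoint_family_on_def)
    have 3: "x = y" if "x \<in> {a\<in>A i. f a = w}" "y \<in> {a\<in>A i. f a = w}" for i x y
      using that B(3)[of i] AB[of i] by (auto simp: inj_on_def)
    show ?thesis unfolding h by (rule infsum_ennreal_disjoint_singletons[OF 1 2 3, symmetric])
  qed
  have "(\<lambda>w. \<Sum>i. h i w) \<in> borel_measurable borel" using hm by measurable
  then show ?meas
    by (rule measurable_discrete_difference[OF _ cfZ]) (auto simp: hsum)
  have piece: "(\<integral>\<^sup>+z. G (f z) * W z * ennreal ((norm (deriv f z))\<^sup>2) * indicator (A i) z \<partial>lborel) =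
     (\<integral>\<^sup>+w. G w * h i w \<partial>lborel)" for i
  proof -
    have Fm: "(\<lambda>z. G (f z) * (W z * indicator (A i) z)) \<in> borel_measurable (restrict_space borel (B i))"
      by (intro borel_measurable_times_ennreal Wm measurable_compose[OF fm G])
    have "(\<integral>\<^sup>+z. G (f z) * W z * ennreal ((norm (deriv f z))\<^sup>2) * indicator (A i) z \<partial>lborel) =
      (\<integral>\<^sup>+z\<in>B i. (G (f z) * (W z * indicator (A i) z)) * ennreal ((norm (deriv f z))\<^sup>2) \<partial>lborel)"
      by (intro nn_integral_cong) (use AB[of i] in \<open>auto simp: indicator_def\<close>)
    also have "\<dots> = (\<integral>\<^sup>+w\<in>f ` B i. G (f (g i w)) * (W (g i w) * indicator (A i) (g i w)) \<partial>lborel)"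
      by (rule nn_integral_holomorphic_substitution(2)[OF holomorphic_on_subset[OF hol B(2)] B(1) B(3) g Fm])
    also have "\<dots> = (\<integral>\<^sup>+w. G w * h i w \<partial>lborel)"
      by (intro nn_integral_cong) (auto simp: h_def indicator_def g)
    finally show ?thesis .
  qed
  have im: "(\<lambda>z. G (f z) * W z * ennreal ((norm (deriv f z))\<^sup>2) * indicator (A i) z) \<in> borel_measurable lborel" for i
  proof -
    have "(\<lambda>z. G (f z) * W z * ennreal ((norm (deriv f z))\<^sup>2)) \<in> borel_measurable (restrict_space borel U)"
      by (intro borel_measurable_times_ennreal W measurable_compose[OF _ measurable_ennreal] 
          borel_measurable_continuous_on_restrict measurable_compose[OF _ G]
          continuous_intros holomorphic_on_imp_continuous_on holomorphic_deriv hol U)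
    from measurable_restrict_space1[OF this, of "A i"] 
    have "(\<lambda>z. G (f z) * W z * ennreal ((norm (deriv f z))\<^sup>2)) \<in> borel_measurable (restrict_space borel (A i))"
      using order_trans[OF AB[of i] B(2)[of i]] U(1) by (simp add: restrict_restrict_space Int_absorb1)
    then show ?thesis by (subst (asm) borel_measurable_restrict_space_iff_ennreal) auto
  qed
  have "(\<integral>\<^sup>+z\<in>U. G (f z) * W z * ennreal ((norm (deriv f z))\<^sup>2) \<partial>lborel) =
    (\<integral>\<^sup>+z. (\<Sum>i. G (f z) * W z * ennreal ((norm (deriv f z))\<^sup>2) * indicator (A i) z) \<partial>lborel)"
  proof (intro nn_integral_cong)
    fix z
    define K where "K = G (f z) * W z * ennreal ((norm (deriv f z))\<^sup>2)"
    have "(\<Sum>i. K * indicator (A i) z) = K * (\<Sum>i. indicator (A i) z)"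
      by (rule ennreal_suminf_cmult)
    also have "(\<Sum>i. indicator (A i) z) = (indicator (\<Union>\<F>) z :: ennreal)"
      using suminf_indicator[OF Adisj, of z] UA by simp
    also have "K * indicator (\<Union>\<F>) z = K * indicator U z"
      using Zd[of z] by (auto simp: Z_def indicator_def \<F>_def K_def)
    finally show "G (f z) * W z * ennreal ((norm (deriv f z))\<^sup>2) * indicator U z =
      (\<Sum>i. G (f z) * W z * ennreal ((norm (deriv f z))\<^sup>2) * indicator (A i) z)"
      unfolding K_def ..
  qed
  also have "\<dots> = (\<Sum>i. \<integral>\<^sup>+z. G (f z) * W z * ennreal ((norm (deriv f z))\<^sup>2) * indicator (A i) z \<partial>lborel)"
    by (rule nn_integral_suminf[OF im])
  also have "\<dots> = (\<Sum>i. \<integral>\<^sup>+w. G w * h i w \<partial>lborel)"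
    by (simp only: piece)
  also have "\<dots> = (\<integral>\<^sup>+w. (\<Sum>i. G w * h i w) \<partial>lborel)"
    by (rule nn_integral_suminf[symmetric]) (use G hm in auto)
  also have "\<dots> = (\<integral>\<^sup>+w. G w * (\<Sum>\<^sub>\<infinity>a\<in>{a\<in>U. f a = w}. W a) \<partial>lborel)"
  proof (rule nn_integral_cong_AE)
    have "AE w in lborel. w \<notin> f ` Z"
      using countable_imp_null_set_lborel[OF cfZ] by (rule AE_not_in)
    then show "AE w in lborel. (\<Sum>i. G w * h i w) = G w * (\<Sum>\<^sub>\<infinity>a\<in>{a\<in>U. f a = w}. W a)"
      by eventually_elim (simp add: ennreal_suminf_cmult hsum)
  qed
  finally show ?eq .
qed

section \<open>Hilbert spaces of functions\<close>

text \<open>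
  The carrier \<open>H\<close> is a set of functions and not a type, so that the Bergman space and the space
  \<open>H\<^sub>\<omega>\<close>, which depend on the weight, are both instances.
\<close>

locale function_hilbert_space =
  fixes H :: "'x cfun set" and ip :: "'x cfun \<Rightarrow> 'x cfun \<Rightarrow> complex"
  assumes zero_mem: "(\<lambda>_. 0) \<in> H"
    and add_mem: "f \<in> H \<Longrightarrow> g \<in> H \<Longrightarrow> (\<lambda>x. f x + g x) \<in> H"
    and scale_mem: "f \<in> H \<Longrightarrow> (\<lambda>x. c * f x) \<in> H"
    and ip_add: "f \<in> H \<Longrightarrow> g \<in> H \<Longrightarrow> h \<in> H \<Longrightarrow> ip (\<lambda>x. f x + g x) h = ip f h + ip g h"
    and ip_scale: "f \<in> H \<Longrightarrow> h \<in> H \<Longrightarrow> ip (\<lambda>x. c * f x) h = c * ip f h"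
    and ip_cnj: "f \<in> H \<Longrightarrow> g \<in> H \<Longrightarrow> ip g f = cnj (ip f g)"
    and ip_nonneg: "f \<in> H \<Longrightarrow> 0 \<le> Re (ip f f)"
    and ip_definite: "f \<in> H \<Longrightarrow> ip f f = 0 \<Longrightarrow> f = (\<lambda>_. 0)"
    and complete: "(\<And>n. s n \<in> H) \<Longrightarrow>
      (\<And>e. e > 0 \<Longrightarrow> \<exists>N. \<forall>m\<ge>N. \<forall>n\<ge>N. ip_norm ip (\<lambda>x. s m x - s n x) < e) \<Longrightarrow>
      \<exists>l\<in>H. (\<lambda>n. ip_norm ip (\<lambda>x. s n x - l x)) \<longlonglongrightarrow> 0"
begin

abbreviation N :: "'x cfun \<Rightarrow> real" where "N \<equiv> ip_norm ip"

lemma N_nonneg: "f \<in> H \<Longrightarrow> 0 \<le> N f"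
  by (simp add: ip_norm_def ip_nonneg)

lemma N_square: "f \<in> H \<Longrightarrow> (N f)\<^sup>2 = Re (ip f f)"
  by (simp add: ip_norm_def ip_nonneg)

lemma ip_self: "f \<in> H \<Longrightarrow> ip f f = of_real ((N f)\<^sup>2)"
  using ip_cnj[of f f] by (simp add: N_square complex_eq_iff)

lemma diff_mem: "f \<in> H \<Longrightarrow> g \<in> H \<Longrightarrow> (\<lambda>x. f x - g x) \<in> H"
  using add_mem[of f "\<lambda>x. (-1) * g x"] scale_mem[of g "-1"] by simp

lemma ip_diff: "f \<in> H \<Longrightarrow> g \<in> H \<Longrightarrow> h \<in> H \<Longrightarrow> ip (\<lambda>x. f x - g x) h = ip f h - ip g h"
  using ip_add[of f "\<lambda>x. (-1) * g x" h] ip_scale[of g h "-1"] scale_mem[of g "-1"] by simp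

lemma ip_diff_right: "f \<in> H \<Longrightarrow> g \<in> H \<Longrightarrow> h \<in> H \<Longrightarrow> ip h (\<lambda>x. f x - g x) = ip h f - ip h g"
  using ip_cnj[OF diff_mem[of f g], of h] ip_diff[of f g h] ip_cnj[of f h] ip_cnj[of g h] by simp

lemma ip_scale_right: "f \<in> H \<Longrightarrow> h \<in> H \<Longrightarrow> ip h (\<lambda>x. c * f x) = cnj c * ip h f"
  using ip_cnj[OF scale_mem[of f c], of h] ip_scale[of f h c] ip_cnj[of f h] by simp

lemma ip_zero: "h \<in> H \<Longrightarrow> ip (\<lambda>_. 0) h = 0"
  using ip_scale[of h h 0] by simp

text \<open>
  The vector \<open>h = f - c g\<close> is the component of \<open>f\<close> orthogonal to \<open>g\<close>; the inequality says that its
  squared norm is non-negative.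
\<close>

lemma cauchy_schwarz:
  assumes f: "f \<in> H" and g: "g \<in> H"
  shows "norm (ip f g) \<le> N f * N g"
proof (cases "ip g g = 0")
  case True
  then have "g = (\<lambda>_. 0)" using g ip_definite by blast
  then have "ip f g = 0" using ip_zero[OF f] ip_cnj[OF f g] by simp
  then show ?thesis using N_nonneg f g by simp
next
  case False
  then have Ng: "N g \<noteq> 0" using ip_self[OF g] by auto
  define c where "c = ip f g / ip g g"
  define h where "h = (\<lambda>x. f x - c * g x)"
  have cg: "(\<lambda>x. c * g x) \<in> H" using g scale_mem by blast
  then have h: "h \<in> H" unfolding h_def using f diff_mem[of f "\<lambda>x. c * g x"] by simp
  have hg: "ip h g = 0"
    using ip_diff[OF f cg g] ip_scale[OF g g, of c] False unfolding h_def by (simp add: c_def)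
  have "ip h h = ip h f - cnj c * ip h g"
    using ip_diff_right[OF f cg h] ip_scale_right[OF g h] unfolding h_def by simp
  also have "\<dots> = ip f f - c * ip g f"
    unfolding hg using ip_diff[OF f cg f] ip_scale[OF g f] unfolding h_def by simp
  also have "c * ip g f = (norm (ip f g))\<^sup>2 / (N g)\<^sup>2"
    unfolding c_def ip_cnj[OF f g] ip_self[OF g]
    by (simp add: complex_norm_square[symmetric])
  finally have "ip h h = of_real ((N f)\<^sup>2 - (norm (ip f g))\<^sup>2 / (N g)\<^sup>2)"
    unfolding ip_self[OF f] by simp
  then have "0 \<le> (N f)\<^sup>2 - (norm (ip f g))\<^sup>2 / (N g)\<^sup>2"
    using ip_nonneg[OF h] by simp
  then have "(norm (ip f g))\<^sup>2 \<le> (N f * N g)\<^sup>2"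
    using Ng by (simp add: field_simps)
  then show ?thesis
    using N_nonneg[OF f] N_nonneg[OF g] by (simp add: power2_le_iff_abs_le)
qed

definition lincomb :: "'x cfun set \<Rightarrow> ('x cfun \<Rightarrow> complex) \<Rightarrow> 'x cfun" where
  "lincomb F c = (\<lambda>x. \<Sum>e\<in>F. c e * e x)"

lemma lincomb_mem: "finite F \<Longrightarrow> F \<subseteq> H \<Longrightarrow> lincomb F c \<in> H"
proof (induction F rule: finite_induct)
  case empty
  then show ?case by (simp add: lincomb_def zero_mem)
next
  case (insert e F)
  then show ?case using add_mem[of "\<lambda>x. c e * e x" "lincomb F c"] scale_mem[of e "c e"]
    by (simp add: lincomb_def)
qed

definition bounded_functional :: "('x cfun \<Rightarrow> complex) \<Rightarrow> real \<Rightarrow> bool" where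
  "bounded_functional L C \<longleftrightarrow> 
    (\<forall>f\<in>H. \<forall>g\<in>H. L (\<lambda>x. f x + g x) = L f + L g) \<and>
    (\<forall>c. \<forall>f\<in>H. L (\<lambda>x. c * f x) = c * L f) \<and>
    (\<forall>f\<in>H. norm (L f) \<le> C * N f)"

lemma bounded_functionalD:
  assumes "bounded_functional L C"
  shows "f \<in> H \<Longrightarrow> g \<in> H \<Longrightarrow> L (\<lambda>x. f x + g x) = L f + L g"
    and "f \<in> H \<Longrightarrow> L (\<lambda>x. c * f x) = c * L f"
    and "f \<in> H \<Longrightarrow> norm (L f) \<le> C * N f"
  using assms by (simp_all add: bounded_functional_def)

lemma bounded_functional_ip: "g \<in> H \<Longrightarrow> bounded_functional (\<lambda>f. ip f g) (N g)"
  unfolding bounded_functional_def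
  using ip_add ip_scale cauchy_schwarz by (auto simp: mult.commute)

lemma bounded_functional_lincomb:
  assumes L: "bounded_functional L C" and "finite F" "F \<subseteq> H"
  shows "L (lincomb F c) = (\<Sum>e\<in>F. c e * L e)"
  using assms(2,3)
proof (induction F rule: finite_induct)
  case empty
  from bounded_functionalD(2)[OF L zero_mem, of 0] show ?case by (simp add: lincomb_def)
next
  case (insert e F)
  have "lincomb (insert e F) c = (\<lambda>x. c e * e x + lincomb F c x)"
    using insert by (simp add: lincomb_def)
  then have "L (lincomb (insert e F) c) = L (\<lambda>x. c e * e x + lincomb F c x)" by simp
  also have "\<dots> = L (\<lambda>x. c e * e x) + L (lincomb F c)"
    by (rule bounded_functionalD(1)[OF L]) (use insert in \<open>auto intro: scale_mem lincomb_mem\<close>)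
  also have "L (\<lambda>x. c e * e x) = c e * L e"
    by (rule bounded_functionalD(2)[OF L]) (use insert in auto)
  finally show ?case using insert by simp
qed

definition orthonormal :: "'x cfun set \<Rightarrow> bool" where
  "orthonormal E \<longleftrightarrow> E \<subseteq> H \<and> (\<forall>e\<in>E. \<forall>e'\<in>E. ip e e' = (if e = e' then 1 else 0))"

lemma ip_lincomb_orthonormal:
  assumes E: "orthonormal E" and F: "finite F" "F \<subseteq> E" and e: "e \<in> E"
  shows "ip (lincomb F c) e = (if e \<in> F then c e else 0)"
proof -
  have "F \<subseteq> H" "e \<in> H" using E F e by (auto simp: orthonormal_def)
  then have "ip (lincomb F c) e = (\<Sum>e'\<in>F. c e' * ip e' e)"
    using bounded_functional_lincomb[OF bounded_functional_ip F(1)] by simp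
  also have "\<dots> = (\<Sum>e'\<in>F. if e' = e then c e' else 0)"
    using E F e by (intro sum.cong) (auto simp: orthonormal_def)
  also have "\<dots> = (if e \<in> F then c e else 0)" using F by (simp add: sum.delta)
  finally show ?thesis .
qed

lemma ip_lincomb_left:
  assumes "finite F" "F \<subseteq> H" "g \<in> H"
  shows "ip (lincomb F c) g = (\<Sum>e\<in>F. c e * ip e g)"
  using bounded_functional_lincomb[OF bounded_functional_ip[OF assms(3)] assms(1,2)] .

lemma N_lincomb_orthonormal:
  assumes E: "orthonormal E" and F: "finite F" "F \<subseteq> E"
  shows "(N (lincomb F c))\<^sup>2 = (\<Sum>e\<in>F. (norm (c e))\<^sup>2)"
proof -
  have FH: "F \<subseteq> H" using E F by (auto simp: orthonormal_def)
  have mem: "lincomb F c \<in> H" by (rule lincomb_mem[OF F(1) FH])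
  have "ip (lincomb F c) (lincomb F c) = (\<Sum>e\<in>F. c e * ip e (lincomb F c))"
    by (rule ip_lincomb_left[OF F(1) FH mem])
  also have "\<dots> = (\<Sum>e\<in>F. of_real ((norm (c e))\<^sup>2))"
  proof (rule sum.cong)
    fix e assume e: "e \<in> F"
    then have "ip e (lincomb F c) = cnj (c e)"
      using ip_cnj[OF mem, of e] ip_lincomb_orthonormal[OF E F, of e c] F FH by (auto simp: subset_iff)
    then show "c e * ip e (lincomb F c) = of_real ((norm (c e))\<^sup>2)"
      by (simp add: complex_norm_square[symmetric])
  qed simp
  finally show ?thesis by (simp add: N_square[OF mem])
qed

text \<open>
  Testing \<open>L\<close> on the vector whose coefficients are the conjugates of \<open>L e\<close> gives a vector
  \<open>u\<close> with \<open>L u = S\<close> and \<open>\<parallel>u\<parallel>\<^sup>2 = S\<close>, so boundedness means \<open>S \<le> C \<surd>S\<close>. For \<open>L = \<langle>\<cdot>, f\<rangle>\<close> this is Bessel's inequality.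
\<close>

lemma bessel_functional:
  assumes E: "orthonormal E" and F: "finite F" "F \<subseteq> E" and L: "bounded_functional L C"
  shows "(\<Sum>e\<in>F. (norm (L e))\<^sup>2) \<le> C\<^sup>2"
proof -
  define S where "S = (\<Sum>e\<in>F. (norm (L e))\<^sup>2)"
  define u where "u = lincomb F (\<lambda>e. cnj (L e))"
  have FH: "F \<subseteq> H" using E F by (auto simp: orthonormal_def)
  have uH: "u \<in> H" unfolding u_def by (rule lincomb_mem[OF F(1) FH])
  have Nu: "(N u)\<^sup>2 = S" unfolding u_def S_def by (simp add: N_lincomb_orthonormal[OF E F])
  have "L u = (\<Sum>e\<in>F. cnj (L e) * L e)"
    unfolding u_def by (rule bounded_functional_lincomb[OF L F(1) FH])
  also have "\<dots> = of_real S" 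
    unfolding S_def of_real_sum by (intro sum.cong refl) (simp only: complex_norm_square mult.commute)
  finally have Lu: "L u = of_real S" .
  have S0: "S \<ge> 0" unfolding S_def by (intro sum_nonneg) auto
  have "S \<le> C * N u"
    using bounded_functionalD(3)[OF L uH] S0 unfolding Lu by simp
  then have "S\<^sup>2 \<le> (C * N u)\<^sup>2" using S0 by (intro power_mono) auto
  then have "S * S \<le> C\<^sup>2 * S" by (simp add: power_mult_distrib Nu power2_eq_square[of S])
  then show ?thesis unfolding S_def[symmetric]
    by (cases "S = 0") (use S0 in auto)
qed

text \<open>
  The Riesz-Fischer theorem. Finite sets whose sums of squared coefficients approach the supremum \<open>S\<close> give a
  Cauchy sequence of linear combinations, since the squared distance of two of them is a sum over
  a symmetric difference. The orthonormal family may be uncountable. The last clause says that the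
  limit lies in the closed span of the family.
\<close>

lemma orthonormal_expansion:
  assumes E: "orthonormal E"
    and B: "\<And>F. finite F \<Longrightarrow> F \<subseteq> E \<Longrightarrow> (\<Sum>e\<in>F. (norm (c e))\<^sup>2) \<le> B"
  shows "\<exists>s\<in>H. (\<forall>e\<in>E. ip s e = c e) \<and>
    (\<forall>\<epsilon>>0. \<exists>F. finite F \<and> F \<subseteq> E \<and> N (\<lambda>x. s x - lincomb F c x) < \<epsilon>)"
proof -
  define Q where "Q = (\<lambda>F. \<Sum>e\<in>F. (norm (c e))\<^sup>2)"
  define \<F> where "\<F> = {F. finite F \<and> F \<subseteq> E}"
  define S where "S = (SUP F\<in>\<F>. Q F)"
  have bdd: "bdd_above (Q ` \<F>)" using B by (auto simp: \<F>_def Q_def intro!: bdd_aboveI)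
  have QS: "Q F \<le> S" if "F \<in> \<F>" for F unfolding S_def by (rule cSUP_upper[OF that bdd])
  have ne: "\<F> \<noteq> {}" by (auto simp: \<F>_def)
  have "\<exists>F\<in>\<F>. S - 1 / real (Suc n) < Q F" for n
    using less_cSUP_iff[OF ne bdd, of "S - 1 / real (Suc n)"] by (simp add: S_def)
  then obtain G where G: "\<And>n. G n \<in> \<F>" "\<And>n. S - 1 / real (Suc n) < Q (G n)" by metis
  have Gf: "finite (G n)" "G n \<subseteq> E" "G n \<subseteq> H" for n 
    using G(1)[of n] E by (auto simp: \<F>_def orthonormal_def)
  define u where "u = (\<lambda>n. lincomb (G n) c)"
  have u: "u n \<in> H" for n unfolding u_def by (rule lincomb_mem[OF Gf(1) Gf(3)])
  have diff: "(N (\<lambda>x. u m x - u n x))\<^sup>2 < 1 / real (Suc m) + 1 / real (Suc n)" for m n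
  proof -
    define d where "d = (\<lambda>e. (if e \<in> G m then c e else 0) - (if e \<in> G n then c e else 0))"
    have fin: "finite (G m \<union> G n)" "G m \<union> G n \<subseteq> E" using Gf by auto
    \<comment> \<open>Both combinations are written over the union, where \<open>d\<close> is supported on the symmetric difference.\<close>
    have "(\<lambda>x. u m x - u n x) = lincomb (G m \<union> G n) d"
    proof
      fix x
      have ind: "(\<Sum>e\<in>G k. c e * e x) = (\<Sum>e\<in>G m \<union> G n. (if e \<in> G k then c e else 0) * e x)" if "k = m \<or> k = n" for k
        using that Gf by (intro sum.mono_neutral_cong_left) auto
      show "u m x - u n x = lincomb (G m \<union> G n) d x"
        unfolding u_def lincomb_def d_def left_diff_distrib sum_subtractf using ind[of m] ind[of n] by simp
    qed
    then have "(N (\<lambda>x. u m x - u n x))\<^sup>2 = (\<Sum>e\<in>G m \<union> G n. (norm (d e))\<^sup>2)"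
      using N_lincomb_orthonormal[OF E fin] by simp
    also have "\<dots> \<le> (\<Sum>e\<in>G m \<union> G n. 2 * (norm (c e))\<^sup>2 - (if e \<in> G m then (norm (c e))\<^sup>2 else 0)
        - (if e \<in> G n then (norm (c e))\<^sup>2 else 0))"
      by (intro sum_mono) (auto simp: d_def)
    also have "\<dots> = 2 * Q (G m \<union> G n) - Q (G m) - Q (G n)"
    proof -
      have ind: "Q (G k) = (\<Sum>e\<in>G m \<union> G n. if e \<in> G k then (norm (c e))\<^sup>2 else 0)" if "k = m \<or> k = n" for k
        unfolding Q_def using that Gf by (intro sum.mono_neutral_cong_left) auto
      show ?thesis
        unfolding sum_subtractf sum_distrib_left[symmetric] using ind[of m] ind[of n] by (simp add: Q_def)
    qed
    also have "\<dots> < 1 / real (Suc m) + 1 / real (Suc n)"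
      using QS[of "G m \<union> G n"] fin G(2)[of m] G(2)[of n] by (simp add: \<F>_def)
    finally show ?thesis .
  qed
  have "\<exists>M. \<forall>m\<ge>M. \<forall>n\<ge>M. N (\<lambda>x. u m x - u n x) < e" if "e > 0" for e
  proof -
    obtain M where M: "inverse (real (Suc M)) < e\<^sup>2 / 2" using \<open>e > 0\<close> reals_Archimedean[of "e\<^sup>2/2"] by auto
    have "N (\<lambda>x. u m x - u n x) < e" if "m \<ge> M" "n \<ge> M" for m n
    proof -
      have "1 / real (Suc k) < e\<^sup>2 / 2" if "k \<ge> M" for k
      proof -
        have "1 / real (Suc k) \<le> 1 / real (Suc M)" using that by (simp add: frac_le)
        then show ?thesis using M by (simp add: inverse_eq_divide)
      qed
      from this[OF that(1)] this[OF that(2)] diff[of m n] have "(N (\<lambda>x. u m x - u n x))\<^sup>2 < e\<^sup>2" by simp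
      then show ?thesis using \<open>e > 0\<close> by (meson less_imp_le power_less_imp_less_base)
    qed
    then show ?thesis by blast
  qed
  from complete[OF u this] obtain s where s: "s \<in> H" "(\<lambda>n. N (\<lambda>x. u n x - s x)) \<longlonglongrightarrow> 0" by blast
  have coeff: "ip s e = c e" if e: "e \<in> E" for e
  proof -
    have eH: "e \<in> H" and Ne: "N e = 1" using e E by (auto simp: orthonormal_def ip_norm_def)
    have "norm (ip (u n) e - ip s e) \<le> N (\<lambda>x. u n x - s x)" for n
      using cauchy_schwarz[OF diff_mem[OF u s(1)] eH, of n] ip_diff[OF u s(1) eH] Ne by simp
    then have 1: "(\<lambda>n. ip (u n) e - ip s e) \<longlonglongrightarrow> 0"
      by (intro Lim_null_comparison[OF _ s(2)] always_eventually) simp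
    have le: "norm (ip (u n) e - c e) \<le> sqrt (1 / real (Suc n))" for n
    proof (cases "e \<in> G n")
      case True
      then show ?thesis unfolding u_def using ip_lincomb_orthonormal[OF E Gf(1,2) e] by simp
    next
      case False
      have "insert e (G n) \<in> \<F>" using e Gf by (auto simp: \<F>_def)
      from QS[OF this] have "(norm (c e))\<^sup>2 + Q (G n) \<le> S" using False Gf by (simp add: Q_def)
      then have "(norm (c e))\<^sup>2 \<le> 1 / real (Suc n)" using G(2)[of n] by simp
      then have "norm (c e) \<le> sqrt (1 / real (Suc n))" by (rule real_le_rsqrt)
      then show ?thesis unfolding u_def using ip_lincomb_orthonormal[OF E Gf(1,2) e] False by simp
    qed
    have "(\<lambda>n. sqrt (1 / real (Suc n))) \<longlonglongrightarrow> sqrt 0"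
      by (intro tendsto_real_sqrt) (use LIMSEQ_inverse_real_of_nat in \<open>simp add: inverse_eq_divide\<close>)
    then have null: "(\<lambda>n. sqrt (1 / real (Suc n))) \<longlonglongrightarrow> 0" by simp
    have 2: "(\<lambda>n. ip (u n) e - c e) \<longlonglongrightarrow> 0"
      by (rule Lim_null_comparison[OF always_eventually null]) (use le in blast)
    from tendsto_diff[OF 1 2] have "(\<lambda>n. c e - ip s e) \<longlonglongrightarrow> 0" by simp
    then show ?thesis by (simp add: LIMSEQ_const_iff)
  qed
  have approx: "\<exists>F. finite F \<and> F \<subseteq> E \<and> N (\<lambda>x. s x - lincomb F c x) < \<epsilon>" if "\<epsilon> > 0" for \<epsilon>
  proof -
    have "\<forall>\<^sub>F n in sequentially. N (\<lambda>x. u n x - s x) < \<epsilon>"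
      using order_tendstoD(2)[OF s(2) that] .
    then obtain n where n: "N (\<lambda>x. u n x - s x) < \<epsilon>" by (auto simp: eventually_sequentially)
    have "ip (\<lambda>x. s x - u n x) (\<lambda>x. s x - u n x) = ip (\<lambda>x. u n x - s x) (\<lambda>x. u n x - s x)"
      using u[of n] s(1) by (simp add: ip_diff ip_diff_right diff_mem)
    then have "N (\<lambda>x. s x - u n x) < \<epsilon>" using n by (simp add: ip_norm_def)
    then show ?thesis using Gf unfolding u_def by blast
  qed
  show ?thesis using s(1) coeff approx by blast
qed

lemma orthonormal_basis_orthonormal: "orthonormal_basis_on H ip E \<Longrightarrow> orthonormal E"
  by (auto simp: orthonormal_basis_on_def orthonormal_def)

text \<open>
  The element with the same coefficients as \<open>f\<close> that is supplied by the Riesz-Fischer theorem differs from \<open>f\<close> by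
  a vector orthogonal to the whole basis, so it equals \<open>f\<close> by maximality.
\<close>

lemma basis_approximation:
  assumes E: "orthonormal_basis_on H ip E" and f: "f \<in> H" and "\<epsilon> > 0"
  shows "\<exists>F. finite F \<and> F \<subseteq> E \<and> N (\<lambda>x. f x - lincomb F (ip f) x) < \<epsilon>"
proof -
  have oE: "orthonormal E" by (rule orthonormal_basis_orthonormal[OF E])
  have EH: "E \<subseteq> H" using oE by (simp add: orthonormal_def)
  have "(\<Sum>e\<in>F. (norm (ip f e))\<^sup>2) \<le> (N f)\<^sup>2" if "finite F" "F \<subseteq> E" for F
  proof -
    have "(\<Sum>e\<in>F. (norm (ip f e))\<^sup>2) = (\<Sum>e\<in>F. (norm (ip e f))\<^sup>2)"
      using that EH f by (intro sum.cong refl) (metis complex_mod_cnj ip_cnj subsetD)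
    then show ?thesis using bessel_functional[OF oE that bounded_functional_ip[OF f]] by simp
  qed
  from orthonormal_expansion[of E "ip f", OF oE this] obtain s where s: "s \<in> H" "\<forall>e\<in>E. ip s e = ip f e"
    "\<forall>\<epsilon>>0. \<exists>F. finite F \<and> F \<subseteq> E \<and> N (\<lambda>x. s x - lincomb F (ip f) x) < \<epsilon>" by blast
  have "\<forall>e\<in>E. ip (\<lambda>x. s x - f x) e = 0"
  proof
    fix e assume "e \<in> E"
    then show "ip (\<lambda>x. s x - f x) e = 0" using ip_diff[OF s(1) f, of e] s(2) EH by auto
  qed
  then have "(\<lambda>x. s x - f x) = (\<lambda>_. 0)"
    using E diff_mem[OF s(1) f] unfolding orthonormal_basis_on_def by blast
  then have "s = f" by (auto simp: fun_eq_iff)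
  then show ?thesis using s(3) \<open>\<epsilon> > 0\<close> by blast
qed

text \<open>
  Bessel's inequality is one half; the other follows since the squared distance of \<open>f\<close> from its
  partial expansion over \<open>F\<close> is the deficit \<open>\<parallel>f\<parallel>\<^sup>2 - S\<close> of the partial sum.
\<close>

theorem parseval:
  assumes E: "orthonormal_basis_on H ip E" and f: "f \<in> H"
  shows "((\<lambda>e. (norm (ip e f))\<^sup>2) has_sum (N f)\<^sup>2) E"
proof -
  have oE: "orthonormal E" by (rule orthonormal_basis_orthonormal[OF E])
  have EH: "E \<subseteq> H" using oE by (simp add: orthonormal_def)
  have bessel: "(\<Sum>e\<in>F. (norm (ip e f))\<^sup>2) \<le> (N f)\<^sup>2" if "finite F" "F \<subseteq> E" for F
    by (rule bessel_functional[OF oE that bounded_functional_ip[OF f]])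
  have summ: "(\<lambda>e. (norm (ip e f))\<^sup>2) summable_on E"
    using bessel by (intro nonneg_bdd_above_summable_on bdd_aboveI) auto
  have "(N f)\<^sup>2 \<le> (\<Sum>\<^sub>\<infinity>e\<in>E. (norm (ip e f))\<^sup>2)"
  proof (rule field_le_epsilon)
    fix \<epsilon> :: real assume "\<epsilon> > 0"
    then obtain F where F: "finite F" "F \<subseteq> E" "N (\<lambda>x. f x - lincomb F (ip f) x) < sqrt \<epsilon>"
      using basis_approximation[OF E f, of "sqrt \<epsilon>"] by auto
    define u where "u = lincomb F (ip f)"
    have FH: "F \<subseteq> H" using F EH by blast
    have u: "u \<in> H" unfolding u_def by (rule lincomb_mem[OF F(1) FH])
    define S where "S = (\<Sum>e\<in>F. (norm (ip e f))\<^sup>2)"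
    have uu: "ip u u = of_real S" 
    proof -
      have "(N u)\<^sup>2 = (\<Sum>e\<in>F. (norm (ip f e))\<^sup>2)"
        unfolding u_def by (rule N_lincomb_orthonormal[OF oE F(1,2)])
      also have "\<dots> = S" unfolding S_def
        using FH f by (intro sum.cong refl) (metis complex_mod_cnj ip_cnj subsetD)
      finally show ?thesis using ip_self[OF u] by simp
    qed
    have uf: "ip u f = of_real S"
    proof -
      have "ip u f = (\<Sum>e\<in>F. ip f e * ip e f)" unfolding u_def by (rule ip_lincomb_left[OF F(1) FH f])
      also have "\<dots> = of_real S" unfolding S_def of_real_sum
      proof (intro sum.cong refl)
        fix e assume "e \<in> F"
        then have "ip f e = cnj (ip e f)" using FH f ip_cnj by blast
        then show "ip f e * ip e f = of_real ((norm (ip e f))\<^sup>2)" by (simp only: complex_norm_square mult.commute)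
      qed
      finally show ?thesis .
    qed
    have fu: "ip f u = of_real S" using ip_cnj[OF u f] uf by simp
    have "ip (\<lambda>x. f x - u x) (\<lambda>x. f x - u x) = ip f f - of_real S"
      using f u by (simp add: ip_diff ip_diff_right diff_mem uu uf fu)
    then have "(N (\<lambda>x. f x - u x))\<^sup>2 = (N f)\<^sup>2 - S"
      using N_square[OF diff_mem[OF f u]] N_square[OF f] by simp
    moreover have "(N (\<lambda>x. f x - u x))\<^sup>2 \<le> (sqrt \<epsilon>)\<^sup>2"
      using F(3) N_nonneg[OF diff_mem[OF f u]] unfolding u_def by (intro power_mono) auto
    ultimately have "(N f)\<^sup>2 \<le> S + \<epsilon>" using \<open>\<epsilon> > 0\<close> by simp
    also have "S \<le> (\<Sum>\<^sub>\<infinity>e\<in>E. (norm (ip e f))\<^sup>2)"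
      unfolding S_def by (rule finite_sum_le_infsum[OF summ F(1,2)]) simp
    finally show "(N f)\<^sup>2 \<le> (\<Sum>\<^sub>\<infinity>e\<in>E. (norm (ip e f))\<^sup>2) + \<epsilon>" by simp
  qed
  moreover have "(\<Sum>\<^sub>\<infinity>e\<in>E. (norm (ip e f))\<^sup>2) \<le> (N f)\<^sup>2"
    by (rule infsum_le_finite_sums[OF summ bessel])
  ultimately show ?thesis using has_sum_infsum[OF summ] by simp
qed

text \<open>
  A maximal orthonormal set exists by Zorn's lemma. It is a basis, because a non-zero vector
  orthogonal to it could be normalised and added.
\<close>

theorem orthonormal_basis_exists: "\<exists>E. orthonormal_basis_on H ip E"
proof -
  have "\<forall>C\<in>chains (Collect orthonormal). \<Union>C \<in> Collect orthonormal"
  proof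
    fix C assume C: "C \<in> chains (Collect orthonormal)"
    have "ip e e' = (if e = e' then 1 else 0)" if ee: "e \<in> \<Union>C" "e' \<in> \<Union>C" for e e'
    proof -
      obtain X Y where XY: "X \<in> C" "Y \<in> C" "e \<in> X" "e' \<in> Y" using ee by blast
      then have "X \<subseteq> Y \<or> Y \<subseteq> X" using C by (auto simp: chains_def chain_subset_def)
      then obtain Z where "Z \<in> C" "e \<in> Z" "e' \<in> Z" using XY by blast
      moreover from this have "orthonormal Z" using C by (auto simp: chains_def)
      ultimately show ?thesis by (auto simp: orthonormal_def)
    qed
    moreover have "\<Union>C \<subseteq> H" using C by (auto simp: chains_def orthonormal_def dest!: subsetD)
    ultimately show "\<Union>C \<in> Collect orthonormal" by (auto simp: orthonormal_def)
  qed
  from Zorn_Lemma[OF this] obtain E where E: "orthonormal E"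
    and max: "\<And>X. orthonormal X \<Longrightarrow> E \<subseteq> X \<Longrightarrow> X = E" by auto
  have "f = (\<lambda>_. 0)" if f: "f \<in> H" and perp: "\<forall>e\<in>E. ip f e = 0" for f
  proof (rule ccontr)
    assume "f \<noteq> (\<lambda>_. 0)"
    then have "ip f f \<noteq> 0" using ip_definite f by blast
    then have Nf: "N f \<noteq> 0" using ip_self[OF f] by auto
    define c where "c = complex_of_real (1 / N f)"
    define g where "g = (\<lambda>x. c * f x)"
    have g: "g \<in> H" unfolding g_def by (rule scale_mem[OF f])
    have gg: "ip g g = 1"
      using ip_scale[OF f g, of c] ip_scale_right[OF f f, of c] ip_self[OF f] Nf
      unfolding g_def by (simp add: c_def power2_eq_square)
    have ge: "ip g e = 0" "ip e g = 0" if "e \<in> E" for e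
    proof -
      have eH: "e \<in> H" using that E by (auto simp: orthonormal_def)
      show "ip g e = 0" unfolding g_def using ip_scale[OF f eH] perp that by simp
      then show "ip e g = 0" using ip_cnj[OF g eH] by simp
    qed
    have "orthonormal (insert g E)"
      using E g gg ge unfolding orthonormal_def by (smt (verit) insert_iff subset_iff zero_neq_one)
    then have "g \<in> E" using max by blast
    then show False using ge(1) gg by auto
  qed
  then have "orthonormal_basis_on H ip E"
    using E by (auto simp: orthonormal_basis_on_def orthonormal_def)
  then show ?thesis ..
qed

text \<open>
  In an orthonormal basis the representing vector must have the coefficients \<open>cnj (L e)\<close>, and these
  are square summable by Bessel's inequality for \<open>L\<close>. The functional it represents agrees with \<open>L\<close>
  on finite linear combinations, which are dense.
\<close>

theorem riesz_representation:
  assumes L: "bounded_functional L C"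
  shows "\<exists>g\<in>H. \<forall>f\<in>H. L f = ip f g"
proof -
  obtain E where E: "orthonormal_basis_on H ip E" using orthonormal_basis_exists by blast
  have oE: "orthonormal E" by (rule orthonormal_basis_orthonormal[OF E])
  have EH: "E \<subseteq> H" using oE by (simp add: orthonormal_def)
  have "(\<Sum>e\<in>F. (norm (cnj (L e)))\<^sup>2) \<le> C\<^sup>2" if "finite F" "F \<subseteq> E" for F
    using bessel_functional[OF oE that L] by simp
  from orthonormal_expansion[of E "\<lambda>e. cnj (L e)", OF oE this]
  obtain g where g: "g \<in> H" "\<forall>e\<in>E. ip g e = cnj (L e)"
    by blast
  have "L f = ip f g" if f: "f \<in> H" for f
  proof (rule ccontr)
    assume "L f \<noteq> ip f g"
    then have pos: "norm (L f - ip f g) > 0" by simp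
    \<comment> \<open>A bound, made positive by the summand 1, for the difference of the two functionals.\<close>
    define D where "D = \<bar>C\<bar> + N g + 1"
    have D: "D > 0" unfolding D_def using N_nonneg[OF g(1)] by linarith
    obtain F where F: "finite F" "F \<subseteq> E" "N (\<lambda>x. f x - lincomb F (ip f) x) < norm (L f - ip f g) / D"
      using basis_approximation[OF E f, of "norm (L f - ip f g) / D"] pos D by auto
    define u where "u = lincomb F (ip f)"
    have FH: "F \<subseteq> H" using F EH by blast
    have u: "u \<in> H" unfolding u_def by (rule lincomb_mem[OF F(1) FH])
    have "L u = (\<Sum>e\<in>F. ip f e * L e)" unfolding u_def by (rule bounded_functional_lincomb[OF L F(1) FH])
    also have "\<dots> = (\<Sum>e\<in>F. ip f e * ip e g)"
    proof (intro sum.cong refl)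
      fix e assume "e \<in> F"
      then have "e \<in> E" "e \<in> H" using F FH by auto
      then show "ip f e * L e = ip f e * ip e g" using g ip_cnj[of g e] by simp
    qed
    also have "\<dots> = ip u g" unfolding u_def by (rule ip_lincomb_left[OF F(1) FH g(1), symmetric])
    finally have Lu: "L u = ip u g" .
    define w where "w = (\<lambda>x. f x - u x)"
    have w: "w \<in> H" unfolding w_def by (rule diff_mem[OF f u])
    have wf: "f = (\<lambda>x. w x + u x)" by (simp add: w_def)
    have "L f = L w + L u" by (subst wf) (rule bounded_functionalD(1)[OF L w u])
    moreover have "ip f g = ip w g + ip u g" by (subst wf) (rule ip_add[OF w u g(1)])
    ultimately have "norm (L f - ip f g) = norm (L w - ip w g)" using Lu by simp
    also have "\<dots> \<le> norm (L w) + norm (ip w g)" by (rule norm_triangle_ineq4)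
    also have "\<dots> \<le> C * N w + N w * N g"
      by (rule add_mono[OF bounded_functionalD(3)[OF L w] cauchy_schwarz[OF w g(1)]])
    also have "\<dots> \<le> D * N w"
    proof -
      have "C * N w \<le> \<bar>C\<bar> * N w" using N_nonneg[OF w] by (intro mult_right_mono) auto
      moreover have "D * N w = \<bar>C\<bar> * N w + N w * N g + N w" by (simp add: D_def algebra_simps)
      ultimately show ?thesis using N_nonneg[OF w] by linarith
    qed
    also have "\<dots> < norm (L f - ip f g)"
      using F(3) D unfolding w_def u_def by (simp add: field_simps)
    finally show False by simp
  qed
  then show ?thesis using g(1) by blast
qed

end

section \<open>Area mean values and the weighted Bergman norm\<close>

lemma nn_integral_ball_rotate:
  fixes F :: "complex \<Rightarrow> ennreal"
  assumes F: "F \<in> borel_measurable (restrict_space borel (ball 0 r))" and c: "norm c = 1"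
  shows "(\<integral>\<^sup>+u\<in>ball 0 r. F (c * u) \<partial>lborel) = (\<integral>\<^sup>+u\<in>ball 0 r. F u \<partial>lborel)"
proof -
  have c0: "c \<noteq> 0" using c by auto
  have img: "(*) c ` ball 0 r = (ball 0 r :: complex set)"
  proof (intro equalityI subsetI)
    fix x :: complex assume "x \<in> ball 0 r"
    then have "x / c \<in> ball 0 r" "x = c * (x / c)" using c c0 by (auto simp: norm_divide)
    then show "x \<in> (*) c ` ball 0 r" by blast
  qed (use c in \<open>auto simp: norm_mult\<close>)
  have m: "(\<lambda>u. F (c * u)) \<in> borel_measurable (restrict_space borel (ball 0 r))"
  proof (rule measurable_compose[OF _ F])
    show "(*) c \<in> restrict_space borel (ball 0 r) \<rightarrow>\<^sub>M restrict_space borel (ball 0 r)"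
      by (rule measurable_restrict_space2)
       (use c in \<open>auto simp: space_restrict_space norm_mult intro!: borel_measurable_continuous_on_restrict continuous_intros\<close>)
  qed
  have d: "deriv ((*) c) u = c" for u by (rule DERIV_imp_deriv) (auto intro!: derivative_eq_intros)
  have "(\<integral>\<^sup>+u\<in>ball 0 r. F (c * u) \<partial>lborel) =
     (\<integral>\<^sup>+u\<in>ball 0 r. F (c * u) * ennreal ((norm (deriv ((*) c) u))\<^sup>2) \<partial>lborel)"
    by (simp add: d c)
  also have "\<dots> = (\<integral>\<^sup>+u\<in>(*) c ` ball 0 r. F (c * (u / c)) \<partial>lborel)"
    by (rule nn_integral_holomorphic_substitution(2))
      (use c0 m in \<open>auto intro!: holomorphic_intros inj_onI\<close>)
  finally show ?thesis using c0 by (simp add: img)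
qed

lemma nn_integral_ball_translate:
  fixes F :: "complex \<Rightarrow> ennreal"
  assumes F: "F \<in> borel_measurable (restrict_space borel (ball w r))"
  shows "(\<integral>\<^sup>+u\<in>ball 0 r. F (w + u) \<partial>lborel) = (\<integral>\<^sup>+u\<in>ball w r. F u \<partial>lborel)"
proof -
  have img: "(+) w ` ball 0 r = ball w r" by simp
  have m: "(\<lambda>u. F (w + u)) \<in> borel_measurable (restrict_space borel (ball 0 r))"
  proof (rule measurable_compose[OF _ F])
    show "(+) w \<in> restrict_space borel (ball 0 r) \<rightarrow>\<^sub>M restrict_space borel (ball w r)"
      by (rule measurable_restrict_space2)
       (auto simp: space_restrict_space dist_norm intro!: borel_measurable_continuous_on_restrict continuous_intros)
  qed
  have d: "deriv ((+) w) u = 1" for u by (rule DERIV_imp_deriv) (auto intro!: derivative_eq_intros)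
  have "(\<integral>\<^sup>+u\<in>ball 0 r. F (w + u) \<partial>lborel) =
     (\<integral>\<^sup>+u\<in>ball 0 r. F (w + u) * ennreal ((norm (deriv ((+) w) u))\<^sup>2) \<partial>lborel)"
    by (simp add: d)
  also have "\<dots> = (\<integral>\<^sup>+u\<in>(+) w ` ball 0 r. F (w + (u - w)) \<partial>lborel)"
    by (rule nn_integral_holomorphic_substitution(2))
      (use m in \<open>auto intro!: holomorphic_intros inj_onI\<close>)
  finally show ?thesis by (simp add: img)
qed

text \<open>
  Cauchy's integral formula on the unit circle, parametrised by the interval from 0 to 1.
\<close>

lemma norm_le_circle_mean:
  assumes hol: "p holomorphic_on ball 0 R" and R: "R > 1"
  shows "ennreal (norm (p 0)) \<le> (\<integral>\<^sup>+t\<in>{0..1}. ennreal (norm (p (exp (2 * of_real pi * \<i> * of_real t)))) \<partial>lborel)"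
proof -
  define c where "c = (\<lambda>t::real. exp (2 * of_real pi * \<i> * of_real t))"
  have nc: "norm (c t) = 1" for t unfolding c_def by simp
  have cc: "continuous_on S c" for S unfolding c_def by (intro continuous_intros)
  have pc: "continuous_on {0..1} (\<lambda>t. p (c t))"
    by (rule continuous_on_compose2[OF holomorphic_on_imp_continuous_on[OF hol] cc])
      (use nc R in auto)
  have "((\<lambda>u. p u / (u - 0)) has_contour_integral (2 * of_real pi * \<i> * p 0)) (circlepath 0 1)"
    by (rule Cauchy_integral_circlepath_simple[OF holomorphic_on_subset[OF hol]]) (use R in auto)
  then have int: "((\<lambda>t. p (circlepath 0 1 t) / (circlepath 0 1 t - 0) *
     vector_derivative (circlepath 0 1) (at t within {0..1})) has_integral (2 * of_real pi * \<i> * p 0)) {0..1}"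
    by (simp add: has_contour_integral_def)
  have "p (circlepath 0 1 t) / (circlepath 0 1 t - 0) *
     vector_derivative (circlepath 0 1) (at t within {0..1}) = (2 * of_real pi * \<i>) * p (c t)" if "t \<in> {0..1}" for t
  proof -
    have "circlepath 0 1 t = c t" by (simp add: circlepath c_def)
    moreover have "vector_derivative (circlepath 0 1) (at t within {0..1}) = 2 * of_real pi * \<i> * c t"
      using that by (simp add: vector_derivative_circlepath01 c_def)
    moreover have "c t \<noteq> 0" by (simp add: c_def)
    ultimately show ?thesis by simp
  qed
  from has_integral_eq[OF this int]
  have "((\<lambda>t. (2 * of_real pi * \<i>) * p (c t)) has_integral (2 * of_real pi * \<i> * p 0)) {0..1}" .
  from has_integral_mult_right[OF this, of "inverse (2 * of_real pi * \<i>)"]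
  have "((\<lambda>t. inverse (2 * of_real pi * \<i>) * (2 * of_real pi * \<i> * p (c t))) has_integral
    inverse (2 * of_real pi * \<i>) * (2 * of_real pi * \<i> * p 0)) {0..1}" .
  moreover have cancel: "inverse (2 * of_real pi * \<i>) * (2 * of_real pi * \<i> * x) = x" for x
    by (subst mult.assoc[symmetric], subst left_inverse) auto
  ultimately have "((\<lambda>t. p (c t)) has_integral p 0) {0..1}" unfolding cancel by simp
  then have p0: "integral {0..1} (\<lambda>t. p (c t)) = p 0" by (rule integral_unique)
  have ni: "(\<lambda>t. norm (p (c t))) integrable_on {0..1}"
    by (intro integrable_continuous_real continuous_intros pc)
  have "norm (integral {0..1} (\<lambda>t. p (c t))) \<le> integral {0..1} (\<lambda>t. norm (p (c t)))"
    by (rule integral_norm_bound_integral[OF integrable_continuous_real[OF pc] ni]) simp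
  then have "ennreal (norm (p 0)) \<le> ennreal (integral {0..1} (\<lambda>t. norm (p (c t))))"
    unfolding p0 by (rule ennreal_leI)
  also have "\<dots> = (\<integral>\<^sup>+t. ennreal (indicator {0..1} t * norm (p (c t))) \<partial>lborel)"
    using nn_integral_has_integral_lebesgue[OF _ integrable_integral[OF ni]] by simp
  also have "\<dots> = (\<integral>\<^sup>+t\<in>{0..1}. ennreal (norm (p (c t))) \<partial>lborel)"
    by (intro nn_integral_cong) (auto simp: indicator_def)
  finally show ?thesis unfolding c_def .
qed

text \<open>
  Rotating the disk by \<open>c t\<close> leaves the area integral of \<open>\<bar>h\<bar>\<close> unchanged, so that integral equals its average
  over all rotations. By Tonelli's theorem the average can be taken inside, where it is a
  mean over circles and bounded below by \<open>\<bar>h w\<bar>\<close>. This avoids polar coordinates.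
\<close>

lemma holomorphic_submean_area:
  assumes hol: "h holomorphic_on ball w r"
  shows "ennreal (norm (h w)) * emeasure lborel (ball 0 r :: complex set) \<le> (\<integral>\<^sup>+z\<in>ball w r. ennreal (norm (h z)) \<partial>lborel)"
proof -
  define c where "c = (\<lambda>t::real. exp (2 * of_real pi * \<i> * of_real t))"
  have nc: "norm (c t) = 1" for t unfolding c_def by simp
  have [measurable]: "c \<in> borel_measurable borel"
    unfolding c_def by (intro borel_measurable_continuous_onI continuous_intros)
  define F where "F = (\<lambda>u. ennreal (norm (h (w + u))))"
  have mF: "F \<in> borel_measurable (restrict_space borel (ball 0 r))"
  proof -
    have "continuous_on (ball 0 r) (\<lambda>u. h (w + u))"
      by (rule continuous_on_compose2[OF holomorphic_on_imp_continuous_on[OF hol]])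
        (auto intro!: continuous_intros simp: dist_norm)
    then show ?thesis unfolding F_def
      by (intro measurable_compose[OF _ measurable_ennreal] borel_measurable_continuous_on_restrict continuous_intros)
  qed
  define k where "k = (\<lambda>u. F u * indicator (ball 0 r) u)"
  have mk [measurable]: "k \<in> borel_measurable borel"
    unfolding k_def using mF by (subst (asm) borel_measurable_restrict_space_iff_ennreal) auto
  have kc: "k (c t * u) = F (c t * u) * indicator (ball 0 r) u" for t u
    by (auto simp: k_def indicator_def norm_mult nc)
  have mean: "ennreal (norm (h w)) * indicator (ball 0 r) u \<le> (\<integral>\<^sup>+t. k (c t * u) * indicator {0..1} t \<partial>lborel)" for u
  proof (cases "u \<in> ball 0 r")
    case True
    \<comment> \<open>The largest radius with \<open>w + u z\<close> inside the disk; any number above 1 does for \<open>u = 0\<close>.\<close>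
    define R where "R = (if u = 0 then 2 else r / norm u)"
    have R: "R > 1" using True by (auto simp: R_def field_simps)
    have mem: "w + u * z \<in> ball w r" if "z \<in> ball 0 R" for z
    proof -
      have "norm u * norm z < r"
      proof (cases "u = 0")
        case False
        then show ?thesis using that by (auto simp: R_def field_simps)
      qed (use True in auto)
      then show ?thesis by (simp add: dist_norm norm_mult)
    qed
    have "(h \<circ> (\<lambda>z. w + u * z)) holomorphic_on ball 0 R"
      by (rule holomorphic_on_compose_gen[OF _ hol]) (use mem in \<open>auto intro!: holomorphic_intros\<close>)
    from norm_le_circle_mean[OF this R]
    have "ennreal (norm (h w)) \<le> (\<integral>\<^sup>+t. F (c t * u) * indicator {0..1} t \<partial>lborel)"
      by (simp add: F_def c_def mult.commute)
    then show ?thesis unfolding kc using True by simp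
  qed simp
  have "ennreal (norm (h w)) * emeasure lborel (ball 0 r :: complex set) =
     (\<integral>\<^sup>+u. ennreal (norm (h w)) * indicator (ball 0 r :: complex set) u \<partial>lborel)"
    by (simp add: nn_integral_cmult_indicator)
  also have "\<dots> \<le> (\<integral>\<^sup>+u. (\<integral>\<^sup>+t. k (c t * u) * indicator {0..1} t \<partial>lborel) \<partial>lborel)"
    by (rule nn_integral_mono) (rule mean)
  also have "\<dots> = (\<integral>\<^sup>+t. (\<integral>\<^sup>+u. k (c t * u) * indicator {0..1} t \<partial>lborel) \<partial>lborel)"
    by (rule lborel_pair.Fubini') measurable
  also have "\<dots> = (\<integral>\<^sup>+t. (\<integral>\<^sup>+u. k u \<partial>lborel) * indicator {0..1::real} t \<partial>lborel)"
  proof (rule nn_integral_cong)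
    fix t :: real
    have "(\<integral>\<^sup>+u. k (c t * u) \<partial>lborel) = (\<integral>\<^sup>+u. k u \<partial>lborel)"
      unfolding kc using nn_integral_ball_rotate[OF mF nc] by (simp add: k_def)
    moreover have "(\<integral>\<^sup>+u. k (c t * u) * indicator {0..1} t \<partial>lborel) = (\<integral>\<^sup>+u. k (c t * u) \<partial>lborel) * indicator {0..1} t"
      by (rule nn_integral_multc) measurable
    ultimately show "(\<integral>\<^sup>+u. k (c t * u) * indicator {0..1} t \<partial>lborel) = (\<integral>\<^sup>+u. k u \<partial>lborel) * indicator {0..1} t"
      by simp
  qed
  also have "\<dots> = (\<integral>\<^sup>+u. k u \<partial>lborel)"
    by (simp add: nn_integral_cmult_indicator)
  also have "\<dots> = (\<integral>\<^sup>+z\<in>ball w r. ennreal (norm (h z)) \<partial>lborel)"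
    unfolding k_def F_def
    by (rule nn_integral_ball_translate)
      (intro measurable_compose[OF _ measurable_ennreal] borel_measurable_continuous_on_restrict 
        continuous_intros holomorphic_on_imp_continuous_on hol)
  finally show ?thesis .
qed

lemma space_area [simp]: "space area = \<D>"
  by (simp add: area_def space_restrict_space)

lemma sets_area: "sets area = sets (restrict_space borel \<D>)"
  by (simp add: area_def sets_restrict_space)

lemma measurable_area: "borel_measurable area = borel_measurable (restrict_space borel \<D>)"
  by (rule measurable_cong_sets[OF sets_area refl])

lemma nn_integral_area:
  assumes "f \<in> borel_measurable (restrict_space borel \<D>)"
  shows "(\<integral>\<^sup>+z. f z \<partial>area) = ennreal (1 / pi) * (\<integral>\<^sup>+z\<in>\<D>. f z \<partial>lborel)"
proof -
  have f: "f \<in> borel_measurable (restrict_space lborel \<D>)"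
    using assms by (simp cong: measurable_cong_sets add: sets_restrict_space)
  have "(\<integral>\<^sup>+z. f z \<partial>area) = (\<integral>\<^sup>+z. ennreal (1 / pi) * f z \<partial>restrict_space lborel \<D>)"
    unfolding area_def by (rule nn_integral_density[OF _ f]) simp
  also have "\<dots> = ennreal (1 / pi) * (\<integral>\<^sup>+z. f z \<partial>restrict_space lborel \<D>)"
    by (rule nn_integral_cmult[OF f])
  also have "(\<integral>\<^sup>+z. f z \<partial>restrict_space lborel \<D>) = (\<integral>\<^sup>+z\<in>\<D>. f z \<partial>lborel)"
    by (rule nn_integral_restrict_space) simp
  finally show ?thesis .
qed

lemma continuous_on_measurable_area: "continuous_on \<D> f \<Longrightarrow> f \<in> borel_measurable area"
  unfolding measurable_area by (rule borel_measurable_continuous_on_restrict)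

lemma weight_continuous_on:
  assumes "weight \<omega>"
  shows "continuous_on {0..<1} \<omega>"
proof -
  obtain \<omega>' where "\<forall>x\<in>{0..<1}. (\<omega> has_real_derivative \<omega>' x) (at x within {0..<1})"
    using assms unfolding weight_def C2_on_def by blast
  then show ?thesis by (intro DERIV_continuous_on) blast
qed

lemma weight_radial_continuous_on:
  assumes "weight \<omega>"
  shows "continuous_on \<D> (\<lambda>z::complex. \<omega> (norm z))"
  by (rule continuous_on_compose2[OF weight_continuous_on[OF assms]])
    (auto intro!: continuous_intros)

lemma weight_pos: "weight \<omega> \<Longrightarrow> z \<in> \<D> \<Longrightarrow> 0 < \<omega> (norm z)"
  by (auto simp: weight_def)

definition bergman_inner :: "(real \<Rightarrow> real) \<Rightarrow> complex cfun \<Rightarrow> complex cfun \<Rightarrow> complex" where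
  "bergman_inner \<omega> f g = (LINT z|area. f z * cnj (g z) * of_real (\<omega> (norm z)))"

lemma bergman_inner_self: "bergman_inner \<omega> f f = of_real (LINT z|area. (norm (f z))\<^sup>2 * \<omega> (norm z))"
  unfolding bergman_inner_def
  by (subst integral_complex_of_real [symmetric])
    (simp add: complex_norm_square [symmetric] flip: of_real_power of_real_mult)

lemma ip_norm_bergman_inner: "ip_norm (bergman_inner \<omega>) f = bergman_norm \<omega> f"
  by (simp add: ip_norm_def bergman_norm_def bergman_inner_self)

lemma analytic_disk_holomorphic: "f \<in> analytic_disk \<Longrightarrow> f holomorphic_on \<D>"
  by (simp add: analytic_disk_def)

lemma bergman_holomorphic: "f \<in> bergman \<omega> \<Longrightarrow> f holomorphic_on \<D>"
  by (simp add: bergman_def analytic_disk_def)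

lemma bergman_integrable: "f \<in> bergman \<omega> \<Longrightarrow> integrable area (\<lambda>z. (norm (f z))\<^sup>2 * \<omega> (norm z))"
  by (simp add: bergman_def)

context
  fixes \<omega> assumes w: "weight \<omega>"
begin

lemma bergman_integrand_measurable:
  assumes "f holomorphic_on \<D>"
  shows "(\<lambda>z. (norm (f z))\<^sup>2 * \<omega> (norm z)) \<in> borel_measurable area"
  by (intro continuous_on_measurable_area continuous_intros weight_radial_continuous_on[OF w]
      holomorphic_on_imp_continuous_on assms)

lemma bergman_iff_nn_integral:
  "f \<in> bergman \<omega> \<longleftrightarrow> f \<in> analytic_disk \<and> (\<integral>\<^sup>+z. ennreal ((norm (f z))\<^sup>2 * \<omega> (norm z)) \<partial>area) < \<infinity>"
proof (cases "f \<in> analytic_disk")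
  case True
  have "(\<integral>\<^sup>+z. ennreal (norm ((norm (f z))\<^sup>2 * \<omega> (norm z))) \<partial>area) = (\<integral>\<^sup>+z. ennreal ((norm (f z))\<^sup>2 * \<omega> (norm z)) \<partial>area)"
    by (intro nn_integral_cong) (use weight_pos[OF w] in \<open>force intro!: arg_cong[where f=ennreal] abs_of_nonneg mult_nonneg_nonneg\<close>)
  then show ?thesis
    using True bergman_integrand_measurable[OF analytic_disk_holomorphic[OF True]]
    by (simp add: bergman_def integrable_iff_bounded)
qed (simp add: bergman_def)

lemma bergman_norm_nn_integral:
  assumes "f \<in> bergman \<omega>"
  shows "ennreal ((bergman_norm \<omega> f)\<^sup>2) = (\<integral>\<^sup>+z. ennreal ((norm (f z))\<^sup>2 * \<omega> (norm z)) \<partial>area)"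
proof -
  have nn: "AE z in area. 0 \<le> (norm (f z))\<^sup>2 * \<omega> (norm z)"
    by (rule AE_I2) (use weight_pos[OF w] in \<open>force intro!: mult_nonneg_nonneg\<close>)
  have "(bergman_norm \<omega> f)\<^sup>2 = (LINT z|area. (norm (f z))\<^sup>2 * \<omega> (norm z))"
    unfolding bergman_norm_def using integral_nonneg_AE[OF nn] by simp
  then show ?thesis using nn_integral_eq_integral[OF bergman_integrable[OF assms] nn] by simp
qed

text \<open>
  The mean value inequality for \<open>f\<^sup>2\<close> bounds \<open>\<bar>f z\<bar>\<^sup>2\<close> by an unweighted area integral over a small
  disk, and on a compact subset of the unit disk the weight is bounded below by a constant
  \<open>m > 0\<close>. The constant \<open>C\<close> is uniform on \<open>\<bar>z\<bar> \<le> \<rho>\<close>, which makes norm convergence locally uniform.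
\<close>

lemma bergman_point_bound:
  assumes "0 \<le> \<rho>" "\<rho> < 1"
  shows "\<exists>C\<ge>0. \<forall>f\<in>bergman \<omega>. \<forall>z. norm z \<le> \<rho> \<longrightarrow> norm (f z) \<le> C * bergman_norm \<omega> f"
proof -
  define \<delta> where "\<delta> = (1 - \<rho>) / 2"
  have \<delta>: "\<delta> > 0" "\<rho> + \<delta> < 1" using assms by (auto simp: \<delta>_def field_simps)
  have ne: "{0..\<rho> + \<delta>} \<noteq> {}" using assms \<delta> by auto
  obtain x where x: "x \<in> {0..\<rho> + \<delta>}" "\<And>y. y \<in> {0..\<rho> + \<delta>} \<Longrightarrow> \<omega> x \<le> \<omega> y"
  proof -
    have "continuous_on {0..\<rho> + \<delta>} \<omega>"
      by (rule continuous_on_subset[OF weight_continuous_on[OF w]]) (use \<delta> in auto)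
    from continuous_attains_inf[OF compact_Icc ne this] show ?thesis using that by blast
  qed
  define m where "m = \<omega> x"
  have m: "m > 0" using x(1) \<delta> w unfolding m_def weight_def by auto
  define V where "V = measure lborel (ball 0 \<delta> :: complex set)"
  have V: "emeasure lborel (ball 0 \<delta> :: complex set) = ennreal V" "V > 0"
  proof -
    show "emeasure lborel (ball 0 \<delta> :: complex set) = ennreal V"
      unfolding V_def by (rule emeasure_eq_ennreal_measure) (use emeasure_lborel_ball_finite[of "0::complex" \<delta>] in auto)
    show "V > 0" unfolding V_def using \<delta> content_ball_pos by blast
  qed
  define C where "C = sqrt (pi / (m * V))"
  have C: "C \<ge> 0" "C\<^sup>2 = pi / (m * V)" unfolding C_def using m V by auto
  have "norm (f z) \<le> C * bergman_norm \<omega> f" if f: "f \<in> bergman \<omega>" and z: "norm z \<le> \<rho>" for f z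
  proof -
    have sub: "norm u \<le> \<rho> + \<delta>" "u \<in> \<D>" if "u \<in> ball z \<delta>" for u
    proof -
      have "norm u \<le> norm z + dist z u" by (metis dist_norm norm_minus_commute norm_triangle_sub)
      then show "norm u \<le> \<rho> + \<delta>" using that z by auto
      then show "u \<in> \<D>" using \<delta> by simp
    qed
    have "(\<lambda>u. (f u)\<^sup>2) holomorphic_on ball z \<delta>"
      by (intro holomorphic_intros holomorphic_on_subset[OF bergman_holomorphic[OF f]]) (use sub in blast)
    from holomorphic_submean_area[OF this]
    have "ennreal ((norm (f z))\<^sup>2) * ennreal V \<le> (\<integral>\<^sup>+u\<in>ball z \<delta>. ennreal ((norm (f u))\<^sup>2) \<partial>lborel)"
      by (simp add: norm_power V)
    also have "\<dots> \<le> (\<integral>\<^sup>+u. ennreal (1 / m) * (ennreal ((norm (f u))\<^sup>2 * \<omega> (norm u)) * indicator \<D> u) \<partial>lborel)"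
    proof (rule nn_integral_mono)
      fix u
      show "ennreal ((norm (f u))\<^sup>2) * indicator (ball z \<delta>) u \<le> ennreal (1 / m) * (ennreal ((norm (f u))\<^sup>2 * \<omega> (norm u)) * indicator \<D> u)"
      proof (cases "u \<in> ball z \<delta>")
        case True
        have "m \<le> \<omega> (norm u)" unfolding m_def using sub(1)[OF True] by (intro x(2)) auto
        then have "(norm (f u))\<^sup>2 * m \<le> (norm (f u))\<^sup>2 * \<omega> (norm u)" by (rule mult_left_mono) simp
        then have "(norm (f u))\<^sup>2 \<le> 1 / m * ((norm (f u))\<^sup>2 * \<omega> (norm u))" using m by (simp add: field_simps)
        then have "ennreal ((norm (f u))\<^sup>2) \<le> ennreal (1 / m * ((norm (f u))\<^sup>2 * \<omega> (norm u)))" by (rule ennreal_leI)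
        also have "\<dots> = ennreal (1 / m) * ennreal ((norm (f u))\<^sup>2 * \<omega> (norm u))"
          by (rule ennreal_mult') (use m in simp)
        finally show ?thesis using True sub(2)[OF True] by simp
      qed simp
    qed
    also have "\<dots> = ennreal (1 / m) * (\<integral>\<^sup>+u\<in>\<D>. ennreal ((norm (f u))\<^sup>2 * \<omega> (norm u)) \<partial>lborel)"
    proof (rule nn_integral_cmult)
      have "(\<lambda>u. ennreal ((norm (f u))\<^sup>2 * \<omega> (norm u))) \<in> borel_measurable (restrict_space borel \<D>)"
        using bergman_integrand_measurable[OF bergman_holomorphic[OF f]] unfolding measurable_area by simp
      then show "(\<lambda>u. ennreal ((norm (f u))\<^sup>2 * \<omega> (norm u)) * indicator \<D> u) \<in> borel_measurable lborel"
        by (subst (asm) borel_measurable_restrict_space_iff_ennreal) auto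
    qed
    also have "(\<integral>\<^sup>+u\<in>\<D>. ennreal ((norm (f u))\<^sup>2 * \<omega> (norm u)) \<partial>lborel) = ennreal pi * ennreal ((bergman_norm \<omega> f)\<^sup>2)"
    proof -
      have "(\<lambda>u. ennreal ((norm (f u))\<^sup>2 * \<omega> (norm u))) \<in> borel_measurable (restrict_space borel \<D>)"
        using bergman_integrand_measurable[OF bergman_holomorphic[OF f]] unfolding measurable_area by simp
      from nn_integral_area[OF this]
      have "ennreal ((bergman_norm \<omega> f)\<^sup>2) = ennreal (1 / pi) * (\<integral>\<^sup>+u\<in>\<D>. ennreal ((norm (f u))\<^sup>2 * \<omega> (norm u)) \<partial>lborel)"
        unfolding bergman_norm_nn_integral[OF f] .
      then have "ennreal pi * ennreal ((bergman_norm \<omega> f)\<^sup>2) = (ennreal pi * ennreal (1 / pi)) * (\<integral>\<^sup>+u\<in>\<D>. ennreal ((norm (f u))\<^sup>2 * \<omega> (norm u)) \<partial>lborel)"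
        by (simp add: mult.assoc)
      also have "ennreal pi * ennreal (1 / pi) = 1" by (simp flip: ennreal_mult)
      finally show ?thesis by simp
    qed
    finally have "ennreal ((norm (f z))\<^sup>2 * V) \<le> ennreal (1 / m * (pi * (bergman_norm \<omega> f)\<^sup>2))"
      using m V by (simp add: ennreal_mult del: times_divide_eq_left)
    then have "(norm (f z))\<^sup>2 * V \<le> 1 / m * (pi * (bergman_norm \<omega> f)\<^sup>2)"
      using m by (subst (asm) ennreal_le_iff) auto
    then have "(norm (f z))\<^sup>2 \<le> (C * bergman_norm \<omega> f)\<^sup>2"
      using m V by (simp add: power_mult_distrib C field_simps)
    moreover have "C * bergman_norm \<omega> f \<ge> 0" using C unfolding bergman_norm_def
      by (intro mult_nonneg_nonneg real_sqrt_ge_zero integral_nonneg_AE AE_I2) (use weight_pos[OF w] in \<open>force intro!: mult_nonneg_nonneg\<close>)+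
    ultimately show ?thesis by (rule power2_le_imp_le)
  qed
  then show ?thesis using C(1) by blast
qed

end

section \<open>The weighted Bergman space and its kernel\<close>

lemma analytic_disk_zero: "(\<lambda>_. 0) \<in> analytic_disk"
  by (simp add: analytic_disk_def)

lemma analytic_disk_add: "f \<in> analytic_disk \<Longrightarrow> g \<in> analytic_disk \<Longrightarrow> (\<lambda>z. f z + g z) \<in> analytic_disk"
  by (auto simp: analytic_disk_def intro!: holomorphic_intros)

lemma analytic_disk_scale: "f \<in> analytic_disk \<Longrightarrow> (\<lambda>z. c * f z) \<in> analytic_disk"
  by (auto simp: analytic_disk_def intro!: holomorphic_intros)

lemma bergman_zero: "(\<lambda>_. 0) \<in> bergman \<omega>"
  by (simp add: bergman_def analytic_disk_zero)

lemma bergman_scale: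
  assumes "f \<in> bergman \<omega>"
  shows "(\<lambda>z. c * f z) \<in> bergman \<omega>"
proof -
  have "integrable area (\<lambda>z. (norm c)\<^sup>2 * ((norm (f z))\<^sup>2 * \<omega> (norm z)))"
    by (rule integrable_mult_right) (rule bergman_integrable[OF assms])
  then show ?thesis
    using assms analytic_disk_scale by (simp add: bergman_def norm_mult power_mult_distrib mult.assoc)
qed

context
  fixes \<omega> assumes w: "weight \<omega>"
begin

lemma bergman_add:
  assumes f: "f \<in> bergman \<omega>" and g: "g \<in> bergman \<omega>"
  shows "(\<lambda>z. f z + g z) \<in> bergman \<omega>"
proof -
  have "integrable area (\<lambda>z. (norm (f z + g z))\<^sup>2 * \<omega> (norm z))"
  proof (rule Bochner_Integration.integrable_bound)
    show "integrable area (\<lambda>z. 2 * ((norm (f z))\<^sup>2 * \<omega> (norm z)) + 2 * ((norm (g z))\<^sup>2 * \<omega> (norm z)))"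
      using bergman_integrable[OF f] bergman_integrable[OF g] by auto
    show "(\<lambda>z. (norm (f z + g z))\<^sup>2 * \<omega> (norm z)) \<in> borel_measurable area"
      by (intro bergman_integrand_measurable[OF w] holomorphic_intros bergman_holomorphic[of _ \<omega>] f g)
    show "AE z in area. norm ((norm (f z + g z))\<^sup>2 * \<omega> (norm z)) \<le>
       norm (2 * ((norm (f z))\<^sup>2 * \<omega> (norm z)) + 2 * ((norm (g z))\<^sup>2 * \<omega> (norm z)))"
    proof (rule AE_I2)
      fix z assume "z \<in> space area"
      then have pos: "0 < \<omega> (norm z)" using weight_pos[OF w] by simp
      have "(norm (f z + g z))\<^sup>2 \<le> (norm (f z) + norm (g z))\<^sup>2"
        by (intro power_mono norm_triangle_ineq) auto
      also have "\<dots> \<le> 2 * (norm (f z))\<^sup>2 + 2 * (norm (g z))\<^sup>2"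
        by (smt (verit) power2_diff power2_sum zero_le_power2)
      finally have "(norm (f z + g z))\<^sup>2 * \<omega> (norm z) \<le> (2 * (norm (f z))\<^sup>2 + 2 * (norm (g z))\<^sup>2) * \<omega> (norm z)"
        using pos by (intro mult_right_mono) auto
      then show "norm ((norm (f z + g z))\<^sup>2 * \<omega> (norm z)) \<le>
       norm (2 * ((norm (f z))\<^sup>2 * \<omega> (norm z)) + 2 * ((norm (g z))\<^sup>2 * \<omega> (norm z)))"
        using pos by (simp add: algebra_simps abs_of_nonneg)
    qed
  qed
  then show ?thesis using f g analytic_disk_add by (simp add: bergman_def)
qed

lemma bergman_diff: "f \<in> bergman \<omega> \<Longrightarrow> g \<in> bergman \<omega> \<Longrightarrow> (\<lambda>z. f z - g z) \<in> bergman \<omega>"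
  using bergman_add[of f "\<lambda>z. (-1) * g z"] bergman_scale[of g \<omega> "-1"] by simp

lemma bergman_inner_integrable:
  assumes f: "f \<in> bergman \<omega>" and g: "g \<in> bergman \<omega>"
  shows "integrable area (\<lambda>z. f z * cnj (g z) * of_real (\<omega> (norm z)))"
proof (rule Bochner_Integration.integrable_bound)
  show "integrable area (\<lambda>z. (norm (f z))\<^sup>2 * \<omega> (norm z) + (norm (g z))\<^sup>2 * \<omega> (norm z))"
    using bergman_integrable[OF f] bergman_integrable[OF g] by auto
  show "(\<lambda>z. f z * cnj (g z) * of_real (\<omega> (norm z))) \<in> borel_measurable area"
    by (intro continuous_on_measurable_area continuous_intros weight_radial_continuous_on[OF w]
        holomorphic_on_imp_continuous_on bergman_holomorphic[of _ \<omega>] f g)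
  show "AE z in area. norm (f z * cnj (g z) * of_real (\<omega> (norm z))) \<le>
       norm ((norm (f z))\<^sup>2 * \<omega> (norm z) + (norm (g z))\<^sup>2 * \<omega> (norm z))"
  proof (rule AE_I2)
    fix z assume "z \<in> space area"
    then have pos: "0 < \<omega> (norm z)" using weight_pos[OF w] by simp
    have "norm (f z) * norm (g z) \<le> (norm (f z))\<^sup>2 + (norm (g z))\<^sup>2"
    proof -
      have "0 \<le> norm (f z) * norm (g z)" by simp
      then show ?thesis using sum_squares_bound[of "norm (f z)" "norm (g z)"] by linarith
    qed
    then have "norm (f z) * norm (g z) * \<omega> (norm z) \<le> ((norm (f z))\<^sup>2 + (norm (g z))\<^sup>2) * \<omega> (norm z)"
      using pos by (intro mult_right_mono) auto
    then show "norm (f z * cnj (g z) * of_real (\<omega> (norm z))) \<le>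
       norm ((norm (f z))\<^sup>2 * \<omega> (norm z) + (norm (g z))\<^sup>2 * \<omega> (norm z))"
      using pos by (simp add: norm_mult algebra_simps abs_of_nonneg)
  qed
qed

lemma bergman_norm_nonneg: "0 \<le> bergman_norm \<omega> f"
  unfolding bergman_norm_def
  by (intro real_sqrt_ge_zero integral_nonneg_AE AE_I2)
    (use weight_pos[OF w] in \<open>force intro!: mult_nonneg_nonneg\<close>)

text \<open>
  The uniform point bound makes a Cauchy sequence in norm locally uniformly Cauchy, and locally
  uniform limits of holomorphic functions are holomorphic.
\<close>

lemma bergman_cauchy_pointwise_limit:
  assumes s: "\<And>n. s n \<in> bergman \<omega>"
    and cauchy: "\<And>e. e > 0 \<Longrightarrow> \<exists>N. \<forall>m\<ge>N. \<forall>n\<ge>N. bergman_norm \<omega> (\<lambda>x. s m x - s n x) < e"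
  shows "\<exists>l\<in>analytic_disk. \<forall>z. (\<lambda>n. s n z) \<longlonglongrightarrow> l z"
proof -
  have unif: "\<exists>N. \<forall>m\<ge>N. \<forall>n\<ge>N. \<forall>z. norm z \<le> \<rho> \<longrightarrow> dist (s m z) (s n z) < e"
    if \<rho>: "0 \<le> \<rho>" "\<rho> < 1" and e: "e > 0" for \<rho> e
  proof -
    obtain C where C: "C \<ge> 0" "\<And>f z. f \<in> bergman \<omega> \<Longrightarrow> norm z \<le> \<rho> \<Longrightarrow> norm (f z) \<le> C * bergman_norm \<omega> f"
      using bergman_point_bound[OF w \<rho>] by blast
    have "e / (C + 1) > 0" using e C(1) by (auto intro: divide_pos_pos)
    from cauchy[OF this] obtain N where
      N: "\<And>m n. m \<ge> N \<Longrightarrow> n \<ge> N \<Longrightarrow> bergman_norm \<omega> (\<lambda>x. s m x - s n x) < e / (C + 1)" by blast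
    have "dist (s m z) (s n z) < e" if "m \<ge> N" "n \<ge> N" "norm z \<le> \<rho>" for m n z
    proof -
      have "norm (s m z - s n z) \<le> C * bergman_norm \<omega> (\<lambda>x. s m x - s n x)"
        using C(2)[OF bergman_diff[OF s s] that(3)] .
      also have "\<dots> \<le> C * (e / (C + 1))" using N[OF that(1,2)] C(1) by (intro mult_left_mono) auto
      also have "\<dots> < e" using C(1) e by (simp add: field_simps)
      finally show ?thesis by (simp add: dist_norm)
    qed
    then show ?thesis by blast
  qed
  have out: "s n z = 0" if "z \<notin> \<D>" for n z using s[of n] that by (auto simp: bergman_def analytic_disk_def)
  have "convergent (\<lambda>n. s n z)" for z
  proof (cases "z \<in> \<D>")
    case True
    have "Cauchy (\<lambda>n. s n z)"
      unfolding Cauchy_def using unif[of "norm z"] True by auto (metis order_refl)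
    then show ?thesis by (rule Cauchy_convergent)
  next
    case False
    then show ?thesis using out by (simp add: convergent_const)
  qed
  then obtain l where l: "\<And>z. (\<lambda>n. s n z) \<longlonglongrightarrow> l z" unfolding convergent_def by metis
  have "l holomorphic_on \<D>"
  proof (rule holomorphic_uniform_sequence[where f = s])
    fix z assume z: "z \<in> \<D>"
    define d where "d = (1 - norm z) / 2"
    have d: "0 < d" "norm z + d < 1" using z by (auto simp: d_def field_simps)
    have nb: "norm u \<le> norm z + d" if "u \<in> cball z d" for u
    proof -
      have "norm u \<le> norm z + dist z u" by (metis dist_norm norm_minus_commute norm_triangle_sub)
      then show ?thesis using that by auto
    qed
    have "uniform_limit (cball z d) s l sequentially"
      unfolding uniform_limit_sequentially_iff
    proof (intro allI impI)
      fix e :: real assume e: "e > 0"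
      obtain N where N: "\<And>m n u. m \<ge> N \<Longrightarrow> n \<ge> N \<Longrightarrow> norm u \<le> norm z + d \<Longrightarrow> dist (s m u) (s n u) < e / 2"
        using unif[of "norm z + d" "e / 2"] d e by auto
      have "dist (s n u) (l u) < e" if "n \<ge> N" "u \<in> cball z d" for n u
      proof -
        have "(\<lambda>m. dist (s n u) (s m u)) \<longlonglongrightarrow> dist (s n u) (l u)" by (intro tendsto_intros l)
        moreover have "\<forall>\<^sub>F m in sequentially. dist (s n u) (s m u) \<le> e / 2"
          using N[OF that(1) _ nb[OF that(2)]] by (intro eventually_sequentiallyI[of N]) (auto intro: less_imp_le)
        ultimately have "dist (s n u) (l u) \<le> e / 2" by (rule tendsto_upperbound) simp
        then show ?thesis using e by simp
      qed
      then show "\<exists>N. \<forall>n\<ge>N. \<forall>x\<in>cball z d. dist (s n x) (l x) < e" by blast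
    qed
    moreover have "cball z d \<subseteq> \<D>" using nb d by force
    ultimately show "\<exists>d>0. cball z d \<subseteq> \<D> \<and> uniform_limit (cball z d) s l sequentially" using d by blast
  qed (use s bergman_holomorphic[of _ \<omega>] in auto)
  moreover have "l z = 0" if "z \<notin> \<D>" for z using l[of z] out[OF that] by (simp add: LIMSEQ_const_iff)
  ultimately show ?thesis using l by (auto simp: analytic_disk_def)
qed

text \<open>
  The pointwise limit is also the limit in norm: by Fatou's lemma \<open>\<parallel>s n - l\<parallel>\<close> is at most the limit
  inferior of \<open>\<parallel>s n - s m\<parallel>\<close> as \<open>m\<close> tends to infinity.
\<close>

lemma bergman_complete:
  assumes s: "\<And>n. s n \<in> bergman \<omega>"
    and cauchy: "\<And>e. e > 0 \<Longrightarrow> \<exists>N. \<forall>m\<ge>N. \<forall>n\<ge>N. bergman_norm \<omega> (\<lambda>x. s m x - s n x) < e"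
  shows "\<exists>l\<in>bergman \<omega>. (\<lambda>n. bergman_norm \<omega> (\<lambda>x. s n x - l x)) \<longlonglongrightarrow> 0"
proof -
  obtain l where l: "l \<in> analytic_disk" "\<And>z. (\<lambda>n. s n z) \<longlonglongrightarrow> l z"
    using bergman_cauchy_pointwise_limit[OF s cauchy] by blast
  have fatou: "(\<integral>\<^sup>+z. ennreal ((norm (s n z - l z))\<^sup>2 * \<omega> (norm z)) \<partial>area) \<le> ennreal (e\<^sup>2)"
    if e: "e > 0" and N: "\<And>m. m \<ge> N \<Longrightarrow> bergman_norm \<omega> (\<lambda>x. s n x - s m x) < e" for n e N
  proof -
    have "(\<integral>\<^sup>+z. ennreal ((norm (s n z - l z))\<^sup>2 * \<omega> (norm z)) \<partial>area) =
       (\<integral>\<^sup>+z. liminf (\<lambda>m. ennreal ((norm (s n z - s m z))\<^sup>2 * \<omega> (norm z))) \<partial>area)"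
    proof (intro nn_integral_cong lim_imp_Liminf[symmetric])
      fix z
      show "(\<lambda>m. ennreal ((norm (s n z - s m z))\<^sup>2 * \<omega> (norm z))) \<longlonglongrightarrow> ennreal ((norm (s n z - l z))\<^sup>2 * \<omega> (norm z))"
        by (intro tendsto_ennrealI tendsto_intros l)
    qed simp
    also have "\<dots> \<le> liminf (\<lambda>m. \<integral>\<^sup>+z. ennreal ((norm (s n z - s m z))\<^sup>2 * \<omega> (norm z)) \<partial>area)"
      by (rule nn_integral_liminf)
        (intro measurable_compose[OF _ measurable_ennreal] bergman_integrand_measurable[OF w] 
          holomorphic_intros bergman_holomorphic[of _ \<omega>] s)
    also have "\<dots> \<le> ennreal (e\<^sup>2)"
    proof (rule order_trans[OF Liminf_le_Limsup Limsup_bounded], simp, rule eventually_sequentiallyI[of N])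
      fix m assume "m \<ge> N"
      have "(\<integral>\<^sup>+z. ennreal ((norm (s n z - s m z))\<^sup>2 * \<omega> (norm z)) \<partial>area) = ennreal ((bergman_norm \<omega> (\<lambda>x. s n x - s m x))\<^sup>2)"
        by (rule bergman_norm_nn_integral[OF w bergman_diff[OF s s], symmetric])
      also have "\<dots> \<le> ennreal (e\<^sup>2)"
        using N[OF \<open>m \<ge> N\<close>] by (intro ennreal_leI power_mono bergman_norm_nonneg) auto
      finally show "(\<integral>\<^sup>+z. ennreal ((norm (s n z - s m z))\<^sup>2 * \<omega> (norm z)) \<partial>area) \<le> ennreal (e\<^sup>2)" .
    qed
    finally show ?thesis .
  qed
  have ad: "(\<lambda>z. s n z - l z) \<in> analytic_disk" for n
    using analytic_disk_add[of "s n" "\<lambda>z. (-1) * l z"] analytic_disk_scale[OF l(1), of "-1"] s[of n]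
    by (simp add: bergman_def)
  have close: "\<exists>N. \<forall>n\<ge>N. (\<lambda>z. s n z - l z) \<in> bergman \<omega> \<and> bergman_norm \<omega> (\<lambda>z. s n z - l z) \<le> e" if e: "e > 0" for e
  proof -
    obtain N where N: "\<And>m n. m \<ge> N \<Longrightarrow> n \<ge> N \<Longrightarrow> bergman_norm \<omega> (\<lambda>x. s m x - s n x) < e"
      using cauchy[OF e] by blast
    have "(\<lambda>z. s n z - l z) \<in> bergman \<omega> \<and> bergman_norm \<omega> (\<lambda>z. s n z - l z) \<le> e" if "n \<ge> N" for n
    proof
      have le: "(\<integral>\<^sup>+z. ennreal ((norm (s n z - l z))\<^sup>2 * \<omega> (norm z)) \<partial>area) \<le> ennreal (e\<^sup>2)"
        by (rule fatou[OF e]) (rule N[OF that])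
      then show mem: "(\<lambda>z. s n z - l z) \<in> bergman \<omega>"
        unfolding bergman_iff_nn_integral[OF w] using ad[of n]
        by (auto intro: le_less_trans)
      have "ennreal ((bergman_norm \<omega> (\<lambda>z. s n z - l z))\<^sup>2) \<le> ennreal (e\<^sup>2)"
        using le bergman_norm_nn_integral[OF w mem] by simp
      then have "(bergman_norm \<omega> (\<lambda>z. s n z - l z))\<^sup>2 \<le> e\<^sup>2" by (subst (asm) ennreal_le_iff) auto
      then show "bergman_norm \<omega> (\<lambda>z. s n z - l z) \<le> e" by (rule power2_le_imp_le) (use e in simp)
    qed
    then show ?thesis by blast
  qed
  obtain n where n: "(\<lambda>z. s n z - l z) \<in> bergman \<omega>" using close[of 1] by auto
  have "l \<in> bergman \<omega>" using bergman_diff[OF s[of n] n] by simp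
  moreover have "(\<lambda>n. bergman_norm \<omega> (\<lambda>x. s n x - l x)) \<longlonglongrightarrow> 0"
  proof (rule LIMSEQ_I)
    fix r :: real assume "r > 0"
    then obtain N where "\<And>n. n \<ge> N \<Longrightarrow> bergman_norm \<omega> (\<lambda>z. s n z - l z) \<le> r / 2"
      using close[of "r / 2"] by auto
    then have "\<forall>n\<ge>N. norm (bergman_norm \<omega> (\<lambda>x. s n x - l x) - 0) < r"
      using bergman_norm_nonneg \<open>r > 0\<close> by force
    then show "\<exists>no. \<forall>n\<ge>no. norm (bergman_norm \<omega> (\<lambda>x. s n x - l x) - 0) < r" by blast
  qed
  ultimately show ?thesis by blast
qed

lemma function_hilbert_space_bergman: "function_hilbert_space (bergman \<omega>) (bergman_inner \<omega>)"
proof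
  show "(\<lambda>_. 0) \<in> bergman \<omega>" by (rule bergman_zero)
  fix f assume f: "f \<in> bergman \<omega>"
  show "(\<lambda>x. c * f x) \<in> bergman \<omega>" for c by (rule bergman_scale[OF f])
  show "0 \<le> Re (bergman_inner \<omega> f f)"
    unfolding bergman_inner_self
    by (simp, intro integral_nonneg_AE AE_I2) (use weight_pos[OF w] in \<open>force intro!: mult_nonneg_nonneg\<close>)
  show "f = (\<lambda>_. 0)" if 0: "bergman_inner \<omega> f f = 0"
  proof
    fix z
    have "bergman_norm \<omega> f = 0" using 0 by (simp add: ip_norm_def flip: ip_norm_bergman_inner)
    show "f z = 0"
    proof (cases "z \<in> \<D>")
      case True
      then have "0 \<le> norm z" "norm z < 1" by auto
      from bergman_point_bound[OF w this] obtain C where "norm (f z) \<le> C * bergman_norm \<omega> f"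
        using f by blast
      then show ?thesis using \<open>bergman_norm \<omega> f = 0\<close> by simp
    qed (use f in \<open>auto simp: bergman_def analytic_disk_def\<close>)
  qed
  fix g assume g: "g \<in> bergman \<omega>"
  show "(\<lambda>x. f x + g x) \<in> bergman \<omega>" by (rule bergman_add[OF f g])
  show "bergman_inner \<omega> (\<lambda>x. c * f x) g = c * bergman_inner \<omega> f g" for c
    unfolding bergman_inner_def by (simp add: mult.assoc)
  show "bergman_inner \<omega> g f = cnj (bergman_inner \<omega> f g)"
    unfolding bergman_inner_def by (subst Bochner_Integration.integral_cnj[symmetric]) (simp add: mult.commute)
  fix h assume h: "h \<in> bergman \<omega>"
  show "bergman_inner \<omega> (\<lambda>x. f x + g x) h = bergman_inner \<omega> f h + bergman_inner \<omega> g h"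
    unfolding bergman_inner_def
    using Bochner_Integration.integral_add[OF bergman_inner_integrable[OF f h] bergman_inner_integrable[OF g h]]
    by (simp add: algebra_simps)
next
  fix s :: "nat \<Rightarrow> complex cfun"
  assume "\<And>n. s n \<in> bergman \<omega>"
    "\<And>e. e > 0 \<Longrightarrow> \<exists>N. \<forall>m\<ge>N. \<forall>n\<ge>N. ip_norm (bergman_inner \<omega>) (\<lambda>x. s m x - s n x) < e"
  then show "\<exists>l\<in>bergman \<omega>. (\<lambda>n. ip_norm (bergman_inner \<omega>) (\<lambda>x. s n x - l x)) \<longlonglongrightarrow> 0"
    unfolding ip_norm_bergman_inner by (rule bergman_complete)
qed

text \<open>
  Point evaluation is bounded, so the Riesz theorem provides a representing vector. It is unique,
  hence it is the one chosen by the description operator in the definition of the kernel.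
\<close>

lemma bergman_kernel_reproducing:
  assumes z: "z \<in> \<D>"
  shows "bergman_kernel \<omega> z \<in> bergman \<omega>"
    and "f \<in> bergman \<omega> \<Longrightarrow> f z = bergman_inner \<omega> f (bergman_kernel \<omega> z)"
proof -
  interpret B: function_hilbert_space "bergman \<omega>" "bergman_inner \<omega>"
    by (rule function_hilbert_space_bergman)
  have "0 \<le> norm z" "norm z < 1" using z by auto
  from bergman_point_bound[OF w this] obtain C where
    C: "\<And>f. f \<in> bergman \<omega> \<Longrightarrow> norm (f z) \<le> C * bergman_norm \<omega> f" by blast
  have "B.bounded_functional (\<lambda>f. f z) C"
    unfolding B.bounded_functional_def ip_norm_bergman_inner using C by simp
  from B.riesz_representation[OF this] obtain R where
    R: "R \<in> bergman \<omega>" "\<And>f. f \<in> bergman \<omega> \<Longrightarrow> f z = bergman_inner \<omega> f R" by blast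
  have "\<exists>!R. R \<in> bergman \<omega> \<and> (\<forall>f\<in>bergman \<omega>. f z = (LINT w|area. f w * cnj (R w) * of_real (\<omega> (norm w))))"
    unfolding bergman_inner_def[symmetric]
  proof (intro ex1I[of _ R] conjI ballI)
    fix R' assume R': "R' \<in> bergman \<omega> \<and> (\<forall>f\<in>bergman \<omega>. f z = bergman_inner \<omega> f R')"
    define d where "d = (\<lambda>x. R' x - R x)"
    have d: "d \<in> bergman \<omega>" unfolding d_def using R' R bergman_diff by blast
    have "bergman_inner \<omega> d d = bergman_inner \<omega> d R' - bergman_inner \<omega> d R"
      using B.ip_diff_right[OF _ R(1) d, of R'] R' by (simp add: d_def)
    also have "\<dots> = 0" using R' R(2)[OF d] d by simp
    finally have "d = (\<lambda>_. 0)" using B.ip_definite[OF d] by blast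
    then show "R' = R" by (auto simp: d_def fun_eq_iff)
  qed (use R in auto)
  from theI'[OF this]
  have *: "bergman_kernel \<omega> z \<in> bergman \<omega> \<and> (\<forall>f\<in>bergman \<omega>. f z = bergman_inner \<omega> f (bergman_kernel \<omega> z))"
    unfolding bergman_kernel_def bergman_inner_def .
  from * show "bergman_kernel \<omega> z \<in> bergman \<omega>" by blast
  from * show "f \<in> bergman \<omega> \<Longrightarrow> f z = bergman_inner \<omega> f (bergman_kernel \<omega> z)" by blast
qed

lemma bergman_kernel_bound:
  assumes z: "z \<in> \<D>" and f: "f \<in> bergman \<omega>"
  shows "norm (f z) \<le> bergman_norm \<omega> f * bergman_norm \<omega> (bergman_kernel \<omega> z)"
proof -
  interpret B: function_hilbert_space "bergman \<omega>" "bergman_inner \<omega>"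
    by (rule function_hilbert_space_bergman)
  show ?thesis
    using B.cauchy_schwarz[OF f bergman_kernel_reproducing(1)[OF z]] bergman_kernel_reproducing(2)[OF z f]
    by (simp add: ip_norm_bergman_inner)
qed

lemma bergman_kernel_diagonal:
  assumes z: "z \<in> \<D>"
  shows "bergman_kernel \<omega> z z = of_real ((bergman_norm \<omega> (bergman_kernel \<omega> z))\<^sup>2)"
proof -
  interpret B: function_hilbert_space "bergman \<omega>" "bergman_inner \<omega>"
    by (rule function_hilbert_space_bergman)
  show ?thesis
    using bergman_kernel_reproducing(2)[OF z bergman_kernel_reproducing(1)[OF z]]
      B.ip_self[OF bergman_kernel_reproducing(1)[OF z]] by (simp add: ip_norm_bergman_inner)
qed

text \<open>
  The norm of \<open>R\<^sub>z\<close> is the supremum of \<open>\<bar>f z\<bar>\<close> over the unit ball, attained by a multiple of \<open>R\<^sub>z\<close>; as a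
  supremum of continuous functions it is lower semicontinuous, hence Borel. The indicator
  extends it to the plane, as the area formula requires.
\<close>

lemma bergman_kernel_norm_measurable:
  "(\<lambda>z. bergman_norm \<omega> (bergman_kernel \<omega> z) * indicator \<D> z) \<in> borel_measurable borel"
proof (rule borel_measurableI_greater)
  fix t :: real
  define k where "k = (\<lambda>z. bergman_norm \<omega> (bergman_kernel \<omega> z))"
  have "open {z\<in>\<D>. t < k z}"
  proof (cases "t < 0")
    case True
    then have "{z\<in>\<D>. t < k z} = \<D>" using bergman_norm_nonneg unfolding k_def by (auto intro: less_le_trans)
    then show ?thesis by simp
  next
    case False
    show ?thesis
    proof (rule openI)
      fix z assume "z \<in> {z\<in>\<D>. t < k z}"
      then have z: "z \<in> \<D>" "t < k z" by auto
      \<comment> \<open>The function \<open>R\<close> certifies the bound \<open>t < k u\<close> for all \<open>u\<close> near \<open>z\<close>.\<close>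
      define R where "R = bergman_kernel \<omega> z"
      have R: "R \<in> bergman \<omega>" unfolding R_def by (rule bergman_kernel_reproducing(1)[OF z(1)])
      have kz: "k z > 0" using z False by linarith
      have "norm (R z) = (k z)\<^sup>2"
        unfolding R_def bergman_kernel_diagonal[OF z(1)] k_def by (simp only: norm_of_real abs_power2)
      then have "z \<in> \<D> \<inter> (\<lambda>u. norm (R u)) -` {t * k z<..}" using z kz by (simp add: power2_eq_square)
      moreover have "continuous_on \<D> (\<lambda>u. norm (R u))"
        by (intro continuous_intros holomorphic_on_imp_continuous_on bergman_holomorphic[OF R])
      then have "open (\<D> \<inter> (\<lambda>u. norm (R u)) -` {t * k z<..})"
        by (intro continuous_open_preimage) auto
      ultimately obtain e where e: "e > 0" "ball z e \<subseteq> \<D> \<inter> (\<lambda>u. norm (R u)) -` {t * k z<..}"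
        unfolding open_contains_ball by blast
      have "ball z e \<subseteq> {z\<in>\<D>. t < k z}"
      proof
        fix u assume "u \<in> ball z e"
        then have u: "u \<in> \<D>" "t * k z < norm (R u)" using e by auto
        have "norm (R u) \<le> k z * k u"
          using bergman_kernel_bound[OF u(1) R] by (simp add: k_def R_def)
        then have "t * k z < k u * k z" using u(2) by (simp add: mult.commute)
        then show "u \<in> {z\<in>\<D>. t < k z}" using u(1) kz by simp
      qed
      then show "\<exists>e>0. ball z e \<subseteq> {z\<in>\<D>. t < k z}" using e(1) by blast
    qed
  qed
  then have o: "{z\<in>\<D>. t < k z} \<in> sets borel" by simp
  have "{z \<in> space borel. t < bergman_norm \<omega> (bergman_kernel \<omega> z) * indicator \<D> z} =
     {z\<in>\<D>. t < k z} \<union> (if t < 0 then - \<D> else {})"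
    by (auto simp: k_def indicator_def)
  then show "{z \<in> space borel. t < bergman_norm \<omega> (bergman_kernel \<omega> z) * indicator \<D> z} \<in> sets borel"
    using o by auto
qed

end

section \<open>The space of functions with derivative in the Bergman space, and composition operators\<close>

text \<open>
  The derivative cut off outside the disk, so that it is again an element of \<^const>\<open>analytic_disk\<close>.
\<close>

definition deriv_disk :: "complex cfun \<Rightarrow> complex cfun" where
  "deriv_disk f = (\<lambda>z. if z \<in> \<D> then deriv f z else 0)"

lemma analytic_disk_field_differentiable:
  "f \<in> analytic_disk \<Longrightarrow> z \<in> \<D> \<Longrightarrow> f field_differentiable at z"
  by (auto simp: analytic_disk_def holomorphic_on_open field_differentiable_def)

lemma deriv_disk_analytic: "f \<in> analytic_disk \<Longrightarrow> deriv_disk f \<in> analytic_disk"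
proof -
  assume "f \<in> analytic_disk"
  then have "deriv f holomorphic_on \<D>"
    by (intro holomorphic_deriv) (auto simp: analytic_disk_def)
  then have "deriv_disk f holomorphic_on \<D>"
    by (rule holomorphic_transform) (simp add: deriv_disk_def)
  then show ?thesis by (simp add: analytic_disk_def deriv_disk_def)
qed

lemma deriv_disk_add:
  "f \<in> analytic_disk \<Longrightarrow> g \<in> analytic_disk \<Longrightarrow>
    deriv_disk (\<lambda>z. f z + g z) = (\<lambda>z. deriv_disk f z + deriv_disk g z)"
  by (auto simp: deriv_disk_def fun_eq_iff analytic_disk_field_differentiable)

lemma deriv_disk_scale:
  "f \<in> analytic_disk \<Longrightarrow> deriv_disk (\<lambda>z. c * f z) = (\<lambda>z. c * deriv_disk f z)"
  by (auto simp: deriv_disk_def fun_eq_iff analytic_disk_field_differentiable)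

lemma deriv_disk_diff:
  "f \<in> analytic_disk \<Longrightarrow> g \<in> analytic_disk \<Longrightarrow>
    deriv_disk (\<lambda>z. f z - g z) = (\<lambda>z. deriv_disk f z - deriv_disk g z)"
  by (auto simp: deriv_disk_def fun_eq_iff analytic_disk_field_differentiable)

lemma deriv_disk_primitive:
  assumes "g \<in> analytic_disk"
  shows "\<exists>f\<in>analytic_disk. f 0 = a \<and> deriv_disk f = g"
proof -
  have "g holomorphic_on \<D>" using assms by (simp add: analytic_disk_def)
  from holomorphic_convex_primitive'[OF _ _ this]
  obtain F where F: "\<And>z. z \<in> \<D> \<Longrightarrow> (F has_field_derivative g z) (at z within \<D>)" by auto
  define f where "f = (\<lambda>z. if z \<in> \<D> then F z - F 0 + a else 0)"
  have f: "(f has_field_derivative g z) (at z)" if z: "z \<in> \<D>" for z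
  proof (rule has_field_derivative_transform_within_open[where S = \<D>])
    have "(F has_field_derivative g z) (at z)" using F[OF z] z by (simp add: at_within_open[OF _ open_ball])
    then show "((\<lambda>z. F z - F 0 + a) has_field_derivative g z) (at z)"
      by (auto intro!: derivative_eq_intros)
  qed (use z in \<open>auto simp: f_def\<close>)
  have "f holomorphic_on \<D>"
    unfolding holomorphic_on_open[OF open_ball] using f by blast
  then have "f \<in> analytic_disk" by (simp add: analytic_disk_def f_def)
  moreover have "deriv_disk f = g"
    using DERIV_imp_deriv[OF f] assms by (auto simp: deriv_disk_def analytic_disk_def fun_eq_iff)
  moreover have "f 0 = a" by (simp add: f_def)
  ultimately show ?thesis by blast
qed

lemma analytic_disk_increment_bound:
  assumes f: "f \<in> analytic_disk" and z: "z \<in> \<D>"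
    and B: "\<And>u. norm u \<le> norm z \<Longrightarrow> norm (deriv_disk f u) \<le> B"
  shows "norm (f z - f 0) \<le> B * norm z"
proof -
  have "norm (f z - f 0) \<le> B * norm (z - 0)"
  proof (rule field_differentiable_bound[of "cball 0 (norm z)"])
    fix u :: complex assume "u \<in> cball 0 (norm z)"
    then have u: "u \<in> \<D>" "norm u \<le> norm z" using z by auto
    show "(f has_field_derivative deriv_disk f u) (at u within cball 0 (norm z))"
      using analytic_disk_field_differentiable[OF f u(1)] u(1)
      by (auto simp: deriv_disk_def field_differentiable_derivI has_field_derivative_at_within)
    show "norm (deriv_disk f u) \<le> B" by (rule B[OF u(2)])
  qed auto
  then show ?thesis by simp
qed

lemma comp_op_analytic:
  assumes hol: "\<phi> holomorphic_on \<D>" and self: "\<phi> ` \<D> \<subseteq> \<D>" and f: "f \<in> analytic_disk"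
  shows "comp_op \<phi> f \<in> analytic_disk"
proof -
  from f have "(f \<circ> \<phi>) holomorphic_on \<D>"
    using self by (intro holomorphic_on_compose_gen[OF hol, of f \<D>]) (auto simp: analytic_disk_def)
  then have "comp_op \<phi> f holomorphic_on \<D>"
    by (rule holomorphic_transform) (simp add: comp_op_def)
  then show ?thesis by (simp add: analytic_disk_def comp_op_def)
qed

lemma deriv_disk_comp_op:
  assumes hol: "\<phi> holomorphic_on \<D>" and self: "\<phi> ` \<D> \<subseteq> \<D>"
    and f: "f \<in> analytic_disk" and z: "z \<in> \<D>"
  shows "deriv_disk (comp_op \<phi> f) z = deriv f (\<phi> z) * deriv \<phi> z"
proof -
  have "\<phi> z \<in> \<D>" using self z by blast
  have "(\<phi> has_field_derivative deriv \<phi> z) (at z)"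
    using hol z holomorphic_derivI[OF hol open_ball] by blast
  moreover have "(f has_field_derivative deriv f (\<phi> z)) (at (\<phi> z))"
    using analytic_disk_field_differentiable[OF f \<open>\<phi> z \<in> \<D>\<close>] by (simp add: field_differentiable_derivI)
  ultimately have "((\<lambda>x. f (\<phi> x)) has_field_derivative deriv f (\<phi> z) * deriv \<phi> z) (at z)"
    using DERIV_chain2 by blast
  then have "(comp_op \<phi> f has_field_derivative deriv f (\<phi> z) * deriv \<phi> z) (at z)"
    by (rule has_field_derivative_transform_within_open[where S = \<D>]) (use z in \<open>auto simp: comp_op_def\<close>)
  then show ?thesis using z DERIV_imp_deriv by (simp add: deriv_disk_def)
qed

lemma hspace_iff: "f \<in> hspace \<omega> \<longleftrightarrow> f \<in> analytic_disk \<and> deriv_disk f \<in> bergman \<omega>"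
proof -
  have "integrable area (\<lambda>z. (norm (deriv f z))\<^sup>2 * \<omega> (norm z)) \<longleftrightarrow>
     integrable area (\<lambda>z. (norm (deriv_disk f z))\<^sup>2 * \<omega> (norm z))"
    by (rule Bochner_Integration.integrable_cong) (auto simp: deriv_disk_def)
  then show ?thesis by (auto simp: hspace_def bergman_def deriv_disk_analytic)
qed

text \<open>
  Together with \<open>hspace_iff\<close> and \<open>deriv_disk_primitive\<close> this identifies \<open>H\<^sub>\<omega>\<close> with the orthogonal sum of the complex
  numbers and the Bergman space, through \<open>f \<mapsto> (f 0, f')\<close>. All Hilbert space properties of \<open>H\<^sub>\<omega>\<close> are
  inherited along this isometry.
\<close>

lemma hspace_inner_eq:
  "hspace_inner \<omega> f g = f 0 * cnj (g 0) + bergman_inner \<omega> (deriv_disk f) (deriv_disk g)"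
proof -
  have "(LINT z|area. deriv f z * cnj (deriv g z) * of_real (\<omega> (norm z))) =
    (LINT z|area. deriv_disk f z * cnj (deriv_disk g z) * of_real (\<omega> (norm z)))"
    by (rule Bochner_Integration.integral_cong) (auto simp: deriv_disk_def)
  then show ?thesis by (simp add: hspace_inner_def bergman_inner_def)
qed

context
  fixes \<omega> assumes w: "weight \<omega>"
begin

interpretation B: function_hilbert_space "bergman \<omega>" "bergman_inner \<omega>"
  by (rule function_hilbert_space_bergman[OF w])

lemma hspace_norm_square:
  assumes "f \<in> hspace \<omega>"
  shows "(ip_norm (hspace_inner \<omega>) f)\<^sup>2 = (norm (f 0))\<^sup>2 + (bergman_norm \<omega> (deriv_disk f))\<^sup>2"
proof -
  have d: "deriv_disk f \<in> bergman \<omega>" using assms by (simp add: hspace_iff)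
  have "Re (hspace_inner \<omega> f f) = (norm (f 0))\<^sup>2 + (bergman_norm \<omega> (deriv_disk f))\<^sup>2"
    unfolding hspace_inner_eq B.ip_self[OF d] ip_norm_bergman_inner
    by (simp add: complex_norm_square[symmetric] flip: of_real_power)
  then show ?thesis by (simp add: ip_norm_def)
qed

lemma hspace_norm_bounds:
  assumes "f \<in> hspace \<omega>"
  shows "norm (f 0) \<le> ip_norm (hspace_inner \<omega>) f"
    and "bergman_norm \<omega> (deriv_disk f) \<le> ip_norm (hspace_inner \<omega>) f"
proof -
  have 0: "0 \<le> ip_norm (hspace_inner \<omega>) f"
    unfolding hspace_norm
    by (intro real_sqrt_ge_zero add_nonneg_nonneg integral_nonneg_AE AE_I2)
      (use weight_pos[OF w] in \<open>force intro!: mult_nonneg_nonneg\<close>)+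
  show "norm (f 0) \<le> ip_norm (hspace_inner \<omega>) f"
    by (rule power2_le_imp_le[OF _ 0]) (simp add: hspace_norm_square[OF assms])
  show "bergman_norm \<omega> (deriv_disk f) \<le> ip_norm (hspace_inner \<omega>) f"
    by (rule power2_le_imp_le[OF _ 0]) (simp add: hspace_norm_square[OF assms])
qed

lemma function_hilbert_space_hspace: "function_hilbert_space (hspace \<omega>) (hspace_inner \<omega>)"
proof
  have "deriv_disk (\<lambda>_. 0) = (\<lambda>_. 0)" by (simp add: deriv_disk_def fun_eq_iff)
  then show "(\<lambda>_. 0) \<in> hspace \<omega>" by (simp add: hspace_iff analytic_disk_zero B.zero_mem)
  fix f assume "f \<in> hspace \<omega>"
  then have f: "f \<in> analytic_disk" "deriv_disk f \<in> bergman \<omega>" and fH: "f \<in> hspace \<omega>" by (auto simp: hspace_iff)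
  show "(\<lambda>x. c * f x) \<in> hspace \<omega>" for c
    by (simp add: hspace_iff analytic_disk_scale deriv_disk_scale B.scale_mem f)
  show "0 \<le> Re (hspace_inner \<omega> f f)"
    unfolding hspace_inner_eq B.ip_self[OF f(2)]
    by (simp add: complex_norm_square[symmetric] flip: of_real_power)
  show "f = (\<lambda>_. 0)" if 0: "hspace_inner \<omega> f f = 0"
  proof -
    have "ip_norm (hspace_inner \<omega>) f = 0" using 0 by (simp add: ip_norm_def)
    then have "(norm (f 0))\<^sup>2 + (bergman_norm \<omega> (deriv_disk f))\<^sup>2 = 0"
      using hspace_norm_square[OF fH] by simp
    then have f0: "f 0 = 0" and "bergman_norm \<omega> (deriv_disk f) = 0"
      by (simp_all add: add_nonneg_eq_0_iff)
    then have d0: "deriv_disk f = (\<lambda>_. 0)"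
      using B.ip_definite[OF f(2)] B.ip_self[OF f(2)] by (simp add: ip_norm_bergman_inner)
    show ?thesis
    proof
      fix z
      show "f z = 0"
      proof (cases "z \<in> \<D>")
        case True
        have "norm (f z - f 0) \<le> 0 * norm z"
          by (rule analytic_disk_increment_bound[OF f(1) True]) (simp add: d0)
        then show ?thesis using f0 by simp
      qed (use f(1) in \<open>auto simp: analytic_disk_def\<close>)
    qed
  qed
  fix g assume "g \<in> hspace \<omega>"
  then have g: "g \<in> analytic_disk" "deriv_disk g \<in> bergman \<omega>" by (auto simp: hspace_iff)
  show "(\<lambda>x. f x + g x) \<in> hspace \<omega>"
    by (simp add: hspace_iff analytic_disk_add deriv_disk_add B.add_mem f g)
  show "hspace_inner \<omega> (\<lambda>x. c * f x) g = c * hspace_inner \<omega> f g" for c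
    unfolding hspace_inner_eq deriv_disk_scale[OF f(1)] B.ip_scale[OF f(2) g(2)] by (simp add: algebra_simps)
  show "hspace_inner \<omega> g f = cnj (hspace_inner \<omega> f g)"
    unfolding hspace_inner_eq B.ip_cnj[OF f(2) g(2)] by simp
  fix h assume "h \<in> hspace \<omega>"
  then have h: "h \<in> analytic_disk" "deriv_disk h \<in> bergman \<omega>" by (auto simp: hspace_iff)
  show "hspace_inner \<omega> (\<lambda>x. f x + g x) h = hspace_inner \<omega> f h + hspace_inner \<omega> g h"
    unfolding hspace_inner_eq deriv_disk_add[OF f(1) g(1)] B.ip_add[OF f(2) g(2) h(2)] by (simp add: algebra_simps)
next
  fix s :: "nat \<Rightarrow> complex cfun"
  assume sH: "\<And>n. s n \<in> hspace \<omega>"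
    and cauchy: "\<And>e. e > 0 \<Longrightarrow> \<exists>N. \<forall>m\<ge>N. \<forall>n\<ge>N. ip_norm (hspace_inner \<omega>) (\<lambda>x. s m x - s n x) < e"
  have s: "s n \<in> analytic_disk" "deriv_disk (s n) \<in> bergman \<omega>" for n using sH by (auto simp: hspace_iff)
  have diff: "(\<lambda>x. f x - g x) \<in> hspace \<omega>" if "f \<in> hspace \<omega>" "g \<in> hspace \<omega>" for f g
    using that analytic_disk_add[of f "\<lambda>z. (-1) * g z"] analytic_disk_scale[of g "-1"]
    by (simp add: hspace_iff deriv_disk_diff B.diff_mem)
  have "Cauchy (\<lambda>n. s n 0)"
    unfolding Cauchy_def dist_norm
    using cauchy hspace_norm_bounds(1)[OF diff[OF sH sH]] by (meson le_less_trans)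
  then obtain a where a: "(\<lambda>n. s n 0) \<longlonglongrightarrow> a" using Cauchy_convergent convergent_def by blast
  have "\<exists>N. \<forall>m\<ge>N. \<forall>n\<ge>N. bergman_norm \<omega> (\<lambda>x. deriv_disk (s m) x - deriv_disk (s n) x) < e" if "e > 0" for e
    using cauchy[OF that] hspace_norm_bounds(2)[OF diff[OF sH sH]]
    unfolding deriv_disk_diff[OF s(1) s(1)] by (meson le_less_trans)
  from bergman_complete[OF w s(2) this] obtain g where g: "g \<in> bergman \<omega>"
    "(\<lambda>n. bergman_norm \<omega> (\<lambda>x. deriv_disk (s n) x - g x)) \<longlonglongrightarrow> 0" by blast
  obtain l where l: "l \<in> analytic_disk" "l 0 = a" "deriv_disk l = g"
    using deriv_disk_primitive[of g a] g(1) by (auto simp: bergman_def)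
  have lH: "l \<in> hspace \<omega>" using l g by (simp add: hspace_iff)
  have "(\<lambda>n. sqrt ((norm (s n 0 - a))\<^sup>2 + (bergman_norm \<omega> (\<lambda>x. deriv_disk (s n) x - g x))\<^sup>2)) \<longlonglongrightarrow> sqrt ((norm (a - a))\<^sup>2 + 0\<^sup>2)"
    by (intro tendsto_intros a g(2))
  moreover have "sqrt ((norm (s n 0 - a))\<^sup>2 + (bergman_norm \<omega> (\<lambda>x. deriv_disk (s n) x - g x))\<^sup>2)
     = ip_norm (hspace_inner \<omega>) (\<lambda>x. s n x - l x)" for n
  proof (rule real_sqrt_unique)
    show "(ip_norm (hspace_inner \<omega>) (\<lambda>x. s n x - l x))\<^sup>2 = (norm (s n 0 - a))\<^sup>2 + (bergman_norm \<omega> (\<lambda>x. deriv_disk (s n) x - g x))\<^sup>2"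
      using hspace_norm_square[OF diff[OF sH lH]] deriv_disk_diff[OF s(1) l(1)] l by simp
    show "0 \<le> ip_norm (hspace_inner \<omega>) (\<lambda>x. s n x - l x)"
      using hspace_norm_bounds(1)[OF diff[OF sH lH], of n] by (rule order_trans[OF norm_ge_zero])
  qed
  ultimately have "(\<lambda>n. ip_norm (hspace_inner \<omega>) (\<lambda>x. s n x - l x)) \<longlonglongrightarrow> 0" by simp
  then show "\<exists>l\<in>hspace \<omega>. (\<lambda>n. ip_norm (hspace_inner \<omega>) (\<lambda>x. s n x - l x)) \<longlonglongrightarrow> 0" using lH by blast
qed

interpretation H: function_hilbert_space "hspace \<omega>" "hspace_inner \<omega>"
  by (rule function_hilbert_space_hspace)

lemma hspace_evaluation_bounded:
  assumes z: "z \<in> \<D>"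
  shows "\<exists>C. H.bounded_functional (\<lambda>f. f z) C"
proof -
  have "0 \<le> norm z" "norm z < 1" using z by auto
  from bergman_point_bound[OF w this] obtain C where C: "C \<ge> 0"
    "\<And>f u. f \<in> bergman \<omega> \<Longrightarrow> norm u \<le> norm z \<Longrightarrow> norm (f u) \<le> C * bergman_norm \<omega> f" by blast
  have "norm (f z) \<le> (1 + C * norm z) * H.N f" if f: "f \<in> hspace \<omega>" for f
  proof -
    have fa: "f \<in> analytic_disk" and fb: "deriv_disk f \<in> bergman \<omega>" using f by (auto simp: hspace_iff)
    have "norm (f z) \<le> norm (f 0) + norm (f z - f 0)" by (metis add.commute diff_add_cancel norm_triangle_ineq)
    also have "\<dots> \<le> H.N f + C * H.N f * norm z"
    proof (rule add_mono)
      show "norm (f 0) \<le> H.N f" by (rule hspace_norm_bounds(1)[OF f])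
      show "norm (f z - f 0) \<le> C * H.N f * norm z"
        by (rule analytic_disk_increment_bound[OF fa z])
          (rule order_trans[OF C(2)[OF fb] mult_left_mono[OF hspace_norm_bounds(2)[OF f] C(1)]])
    qed
    finally show ?thesis by (simp add: algebra_simps)
  qed
  then show ?thesis unfolding H.bounded_functional_def by auto
qed

text \<open>
  The key identity. Let \<open>k\<close> be the primitive of \<open>R\<^sub>z\<close> that vanishes at 0. By the reproducing property
  the functional \<open>f \<mapsto> f' z\<close> on \<open>H\<^sub>\<omega>\<close> is represented by \<open>k\<close>, and \<open>\<parallel>k\<parallel> = \<parallel>R\<^sub>z\<parallel>\<close>. Parseval's identity for
  \<open>k\<close> then gives the same value for every orthonormal basis.
\<close>

lemma basis_derivative_has_sum:
  assumes E: "orthonormal_basis_on (hspace \<omega>) (hspace_inner \<omega>) E" and z: "z \<in> \<D>"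
  shows "((\<lambda>e. (norm (deriv e z))\<^sup>2) has_sum (bergman_norm \<omega> (bergman_kernel \<omega> z))\<^sup>2) E"
proof -
  define R where "R = bergman_kernel \<omega> z"
  have R: "R \<in> bergman \<omega>" unfolding R_def by (rule bergman_kernel_reproducing(1)[OF w z])
  then obtain k where k: "k \<in> analytic_disk" "k 0 = 0" "deriv_disk k = R"
    using deriv_disk_primitive[of R 0] by (auto simp: bergman_def)
  have kH: "k \<in> hspace \<omega>" using k R by (simp add: hspace_iff)
  have rep: "hspace_inner \<omega> e k = deriv e z" if "e \<in> E" for e
  proof -
    have "e \<in> hspace \<omega>" using that E by (auto simp: orthonormal_basis_on_def)
    then have "deriv_disk e \<in> bergman \<omega>" by (simp add: hspace_iff)
    from bergman_kernel_reproducing(2)[OF w z this] show ?thesis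
      using k z by (simp add: hspace_inner_eq R_def deriv_disk_def)
  qed
  have "(H.N k)\<^sup>2 = (bergman_norm \<omega> R)\<^sup>2"
    by (simp add: hspace_norm_square[OF kH] k)
  moreover have "((\<lambda>e. (norm (deriv e z))\<^sup>2) has_sum (H.N k)\<^sup>2) E"
    using H.parseval[OF E kH] rep by (simp cong: has_sum_cong)
  ultimately show ?thesis unfolding R_def by simp
qed

context
  fixes \<phi> :: "complex \<Rightarrow> complex"
  assumes hol: "\<phi> holomorphic_on \<D>" and self: "\<phi> ` \<D> \<subseteq> \<D>"
begin

text \<open>
  The integral of the theorem, pulled back to the domain of \<open>\<phi>\<close>.
\<close>

definition kernel_energy :: ennreal where
  "kernel_energy = (\<integral>\<^sup>+z. ennreal ((bergman_norm \<omega> (bergman_kernel \<omega> (\<phi> z)))\<^sup>2 * ((norm (deriv \<phi> z))\<^sup>2 * \<omega> (norm z))) \<partial>area)"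

text \<open>
  The area formula with the weight \<open>\<omega>(\<bar>a\<bar>)\<close> attached to a preimage \<open>a\<close>: the sum over the fibre of
  \<open>z\<close> is then the counting function.
\<close>

lemma kernel_energy_eq_nevanlinna:
  "kernel_energy = (\<integral>\<^sup>+z. ennreal ((bergman_norm \<omega> (bergman_kernel \<omega> z))\<^sup>2) * nevanlinna \<phi> \<omega> z \<partial>area)"
proof -
  define G where "G = (\<lambda>z. ennreal ((bergman_norm \<omega> (bergman_kernel \<omega> z) * indicator \<D> z)\<^sup>2))"
  have Gm: "G \<in> borel_measurable borel"
    unfolding G_def using bergman_kernel_norm_measurable[OF w] by measurable
  define W where "W = (\<lambda>z::complex. ennreal (\<omega> (norm z)))"
  have Wm: "W \<in> borel_measurable (restrict_space borel \<D>)"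
    unfolding W_def by (intro measurable_compose[OF _ measurable_ennreal] borel_measurable_continuous_on_restrict
        weight_radial_continuous_on[OF w])
  note af = nn_integral_area_formula[OF hol open_ball _ Wm Gm]
  have nev: "nevanlinna \<phi> \<omega> z = (\<Sum>\<^sub>\<infinity>a\<in>{a\<in>\<D>. \<phi> a = z}. W a)" for z
    by (simp add: nevanlinna_def W_def)
  have nevm: "nevanlinna \<phi> \<omega> \<in> borel_measurable borel"
    unfolding nev by (rule af(1)) simp
  have "\<phi> \<in> borel_measurable (restrict_space borel \<D>)"
    by (intro borel_measurable_continuous_on_restrict holomorphic_on_imp_continuous_on hol)
  note phim = measurable_compose[OF this Gm]
  have dm: "(\<lambda>z. ennreal ((norm (deriv \<phi> z))\<^sup>2)) \<in> borel_measurable (restrict_space borel \<D>)"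
    by (intro measurable_compose[OF _ measurable_ennreal] borel_measurable_continuous_on_restrict
        continuous_intros holomorphic_on_imp_continuous_on holomorphic_deriv hol open_ball)
  have "kernel_energy = (\<integral>\<^sup>+z. G (\<phi> z) * W z * ennreal ((norm (deriv \<phi> z))\<^sup>2) \<partial>area)"
    unfolding kernel_energy_def
  proof (rule nn_integral_cong)
    fix z assume "z \<in> space area"
    then have z: "z \<in> \<D>" by simp
    then have "\<phi> z \<in> \<D>" using self by blast
    then show "ennreal ((bergman_norm \<omega> (bergman_kernel \<omega> (\<phi> z)))\<^sup>2 * ((norm (deriv \<phi> z))\<^sup>2 * \<omega> (norm z))) =
        G (\<phi> z) * W z * ennreal ((norm (deriv \<phi> z))\<^sup>2)"
      unfolding G_def W_def using weight_pos[OF w z] by (simp add: ennreal_mult mult.assoc mult.commute[of "ennreal (\<omega> (norm z))"])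
  qed
  also have "\<dots> = ennreal (1 / pi) * (\<integral>\<^sup>+z\<in>\<D>. G (\<phi> z) * W z * ennreal ((norm (deriv \<phi> z))\<^sup>2) \<partial>lborel)"
    by (rule nn_integral_area) (intro borel_measurable_times_ennreal phim Wm dm)
  also have "(\<integral>\<^sup>+z\<in>\<D>. G (\<phi> z) * W z * ennreal ((norm (deriv \<phi> z))\<^sup>2) \<partial>lborel) = (\<integral>\<^sup>+z. G z * nevanlinna \<phi> \<omega> z \<partial>lborel)"
    unfolding nev by (rule af(2)) simp
  also have "\<dots> = (\<integral>\<^sup>+z\<in>\<D>. G z * nevanlinna \<phi> \<omega> z \<partial>lborel)"
    by (intro nn_integral_cong) (auto simp: G_def indicator_def)
  also have "ennreal (1 / pi) * \<dots> = (\<integral>\<^sup>+z. G z * nevanlinna \<phi> \<omega> z \<partial>area)"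
    by (rule nn_integral_area[symmetric])
      (intro borel_measurable_times_ennreal measurable_restrict_space1 Gm nevm)
  also have "\<dots> = (\<integral>\<^sup>+z. ennreal ((bergman_norm \<omega> (bergman_kernel \<omega> z))\<^sup>2) * nevanlinna \<phi> \<omega> z \<partial>area)"
    by (intro nn_integral_cong) (auto simp: G_def)
  finally show ?thesis .
qed

text \<open>
  The weighted Dirichlet energy of \<open>f \<circ> \<phi>\<close>, written with the chain rule so that \<open>f\<close> enters only through
  its derivative on the range of \<open>\<phi>\<close>.
\<close>

definition pullback_energy :: "complex cfun \<Rightarrow> ennreal" where
  "pullback_energy f = (\<integral>\<^sup>+z. ennreal ((norm (deriv f (\<phi> z)))\<^sup>2 * ((norm (deriv \<phi> z))\<^sup>2 * \<omega> (norm z))) \<partial>area)"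

lemma pullback_energy_eq:
  assumes "f \<in> analytic_disk"
  shows "pullback_energy f = (\<integral>\<^sup>+z. ennreal ((norm (deriv_disk (comp_op \<phi> f) z))\<^sup>2 * \<omega> (norm z)) \<partial>area)"
  unfolding pullback_energy_def
  by (intro nn_integral_cong) (use deriv_disk_comp_op[OF hol self assms] in \<open>simp add: norm_mult power_mult_distrib mult.assoc\<close>)

lemma comp_op_mem_iff:
  assumes "f \<in> analytic_disk"
  shows "comp_op \<phi> f \<in> hspace \<omega> \<longleftrightarrow> pullback_energy f < \<infinity>"
  unfolding hspace_iff bergman_iff_nn_integral[OF w] pullback_energy_eq[OF assms]
  using comp_op_analytic[OF hol self assms] deriv_disk_analytic by blast

lemma comp_op_norm:
  assumes f: "f \<in> analytic_disk" and T: "comp_op \<phi> f \<in> hspace \<omega>"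
  shows "ennreal ((H.N (comp_op \<phi> f))\<^sup>2) = ennreal ((norm (f (\<phi> 0)))\<^sup>2) + pullback_energy f"
proof -
  have "deriv_disk (comp_op \<phi> f) \<in> bergman \<omega>" using T by (simp add: hspace_iff)
  from bergman_norm_nn_integral[OF w this] show ?thesis
    unfolding hspace_norm_square[OF T] pullback_energy_eq[OF f]
    by (simp add: ennreal_plus comp_op_def)
qed

lemma pullback_integrand_measurable:
  assumes f: "f \<in> analytic_disk"
  shows "(\<lambda>z. ennreal ((norm (deriv f (\<phi> z)))\<^sup>2 * ((norm (deriv \<phi> z))\<^sup>2 * \<omega> (norm z)))) \<in> borel_measurable area"
proof -
  have 1: "continuous_on \<D> (\<lambda>z. deriv f (\<phi> z))"
    by (rule continuous_on_compose2[of \<D>]; (intro holomorphic_on_imp_continuous_on holomorphic_deriv hol open_ball)?)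
      (use f self in \<open>auto simp: analytic_disk_def\<close>)
  have 2: "continuous_on \<D> (deriv \<phi>)"
    by (intro holomorphic_on_imp_continuous_on holomorphic_deriv hol open_ball)
  show ?thesis
    by (intro measurable_compose[OF _ measurable_ennreal] continuous_on_measurable_area
        continuous_intros 1 2 weight_radial_continuous_on[OF w])
qed

lemma jacobian_nonneg: "z \<in> \<D> \<Longrightarrow> 0 \<le> (norm (deriv \<phi> z))\<^sup>2 * \<omega> (norm z)"
  using weight_pos[OF w, of z] by simp

text \<open>
  The pointwise identity for the basis, truncated to a finite part and integrated along \<open>\<phi>\<close>.
\<close>

lemma sum_pullback_energy_le:
  assumes E: "orthonormal_basis_on (hspace \<omega>) (hspace_inner \<omega>) E" and F: "finite F" "F \<subseteq> E"
  shows "(\<Sum>e\<in>F. pullback_energy e) \<le> kernel_energy"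
proof -
  have EH: "E \<subseteq> analytic_disk" using E by (auto simp: orthonormal_basis_on_def hspace_iff)
  have "(\<Sum>e\<in>F. pullback_energy e) =
    (\<integral>\<^sup>+z. (\<Sum>e\<in>F. ennreal ((norm (deriv e (\<phi> z)))\<^sup>2 * ((norm (deriv \<phi> z))\<^sup>2 * \<omega> (norm z)))) \<partial>area)"
    unfolding pullback_energy_def
    by (rule nn_integral_sum[symmetric]) (use pullback_integrand_measurable F EH in blast)
  also have "\<dots> \<le> kernel_energy"
    unfolding kernel_energy_def
  proof (rule nn_integral_mono)
    fix z assume "z \<in> space area"
    then have z: "z \<in> \<D>" by simp
    then have pz: "\<phi> z \<in> \<D>" using self by blast
    have "(\<Sum>e\<in>F. (norm (deriv e (\<phi> z)))\<^sup>2) \<le> (bergman_norm \<omega> (bergman_kernel \<omega> (\<phi> z)))\<^sup>2"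
      by (rule finite_sum_le_has_sum[OF basis_derivative_has_sum[OF E pz] F]) simp
    then have "(\<Sum>e\<in>F. (norm (deriv e (\<phi> z)))\<^sup>2) * ((norm (deriv \<phi> z))\<^sup>2 * \<omega> (norm z))
      \<le> (bergman_norm \<omega> (bergman_kernel \<omega> (\<phi> z)))\<^sup>2 * ((norm (deriv \<phi> z))\<^sup>2 * \<omega> (norm z))"
      by (rule mult_right_mono[OF _ jacobian_nonneg[OF z]])
    then show "(\<Sum>e\<in>F. ennreal ((norm (deriv e (\<phi> z)))\<^sup>2 * ((norm (deriv \<phi> z))\<^sup>2 * \<omega> (norm z)))) \<le>
      ennreal ((bergman_norm \<omega> (bergman_kernel \<omega> (\<phi> z)))\<^sup>2 * ((norm (deriv \<phi> z))\<^sup>2 * \<omega> (norm z)))"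
      by (subst sum_ennreal) (auto simp: sum_distrib_right jacobian_nonneg[OF z] intro!: ennreal_leI mult_nonneg_nonneg)
  qed
  finally show ?thesis .
qed

text \<open>
  This gives boundedness of the operator directly, since \<open>\<bar>f' z\<bar> \<le> \<parallel>f\<parallel> \<parallel>R\<^sub>z\<parallel>\<close> by the reproducing
  property.
\<close>

lemma pullback_energy_le:
  assumes f: "f \<in> hspace \<omega>"
  shows "pullback_energy f \<le> ennreal ((H.N f)\<^sup>2) * kernel_energy"
proof -
  have fb: "deriv_disk f \<in> bergman \<omega>" using f by (simp add: hspace_iff)
  define K where "K = (\<lambda>z. (bergman_norm \<omega> (bergman_kernel \<omega> (\<phi> z)))\<^sup>2)"
  have "pullback_energy f \<le> (\<integral>\<^sup>+z. ennreal ((H.N f)\<^sup>2 * (K z * ((norm (deriv \<phi> z))\<^sup>2 * \<omega> (norm z)))) \<partial>area)"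
    unfolding pullback_energy_def
  proof (rule nn_integral_mono, rule ennreal_leI)
    fix z assume "z \<in> space area"
    then have z: "z \<in> \<D>" by simp
    then have pz: "\<phi> z \<in> \<D>" using self by blast
    have "norm (deriv f (\<phi> z)) \<le> bergman_norm \<omega> (deriv_disk f) * bergman_norm \<omega> (bergman_kernel \<omega> (\<phi> z))"
      using bergman_kernel_bound[OF w pz fb] pz by (simp add: deriv_disk_def)
    also have "\<dots> \<le> H.N f * bergman_norm \<omega> (bergman_kernel \<omega> (\<phi> z))"
      by (rule mult_right_mono[OF hspace_norm_bounds(2)[OF f] bergman_norm_nonneg[OF w]])
    finally have "(norm (deriv f (\<phi> z)))\<^sup>2 \<le> (H.N f * bergman_norm \<omega> (bergman_kernel \<omega> (\<phi> z)))\<^sup>2"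
      by (intro power_mono) auto
    then have "(norm (deriv f (\<phi> z)))\<^sup>2 \<le> (H.N f)\<^sup>2 * K z" by (simp add: power_mult_distrib K_def)
    from mult_right_mono[OF this jacobian_nonneg[OF z]]
    show "(norm (deriv f (\<phi> z)))\<^sup>2 * ((norm (deriv \<phi> z))\<^sup>2 * \<omega> (norm z)) \<le> (H.N f)\<^sup>2 * (K z * ((norm (deriv \<phi> z))\<^sup>2 * \<omega> (norm z)))"
      by (simp add: mult.assoc)
  qed
  also have "\<dots> = (\<integral>\<^sup>+z. ennreal ((H.N f)\<^sup>2) * ennreal (K z * ((norm (deriv \<phi> z))\<^sup>2 * \<omega> (norm z))) \<partial>area)"
    by (intro nn_integral_cong ennreal_mult) (use jacobian_nonneg in \<open>auto simp: K_def intro!: mult_nonneg_nonneg\<close>)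
  also have "\<dots> = ennreal ((H.N f)\<^sup>2) * kernel_energy"
    unfolding kernel_energy_def K_def
  proof (rule nn_integral_cmult)
    have "(\<lambda>z. (bergman_norm \<omega> (bergman_kernel \<omega> (\<phi> z)) * indicator \<D> (\<phi> z))) \<in> borel_measurable area"
      using measurable_compose[OF continuous_on_measurable_area[OF holomorphic_on_imp_continuous_on[OF hol]] 
          bergman_kernel_norm_measurable[OF w]] by simp
    then have "(\<lambda>z. bergman_norm \<omega> (bergman_kernel \<omega> (\<phi> z))) \<in> borel_measurable area"
    proof (rule measurable_cong[THEN iffD1, rotated])
      fix z assume "z \<in> space area"
      then have "z \<in> \<D>" by simp
      then have "\<phi> z \<in> \<D>" using self by blast
      then show "bergman_norm \<omega> (bergman_kernel \<omega> (\<phi> z)) * indicator \<D> (\<phi> z) = bergman_norm \<omega> (bergman_kernel \<omega> (\<phi> z))"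
        by simp
    qed
    moreover have "(\<lambda>z. (norm (deriv \<phi> z))\<^sup>2 * \<omega> (norm z)) \<in> borel_measurable area"
      by (intro bergman_integrand_measurable[OF w] holomorphic_deriv hol open_ball)
    ultimately show "(\<lambda>z. ennreal ((bergman_norm \<omega> (bergman_kernel \<omega> (\<phi> z)))\<^sup>2 * ((norm (deriv \<phi> z))\<^sup>2 * \<omega> (norm z)))) \<in> borel_measurable area"
      by measurable
  qed
  finally show ?thesis .
qed

text \<open>
  By \<open>comp_op_norm\<close> the squared norm of \<open>e \<circ> \<phi>\<close> splits into \<open>\<bar>e (\<phi> 0)\<bar>\<^sup>2\<close> and an energy. Sums of the
  first kind are controlled by Bessel's inequality for the evaluation at \<open>\<phi> 0\<close>, sums of the second
  kind by the kernel energy.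
\<close>

lemma hilbert_schmidt_if_kernel_energy_finite:
  assumes fin: "kernel_energy < \<infinity>"
  shows "hilbert_schmidt_on (hspace \<omega>) (hspace_inner \<omega>) (comp_op \<phi>)"
proof -
  obtain I where I: "kernel_energy = ennreal I" "I \<ge> 0" using fin by (cases kernel_energy) auto
  have "\<phi> 0 \<in> \<D>" using self by (simp add: image_subset_iff)
  then obtain C where C: "H.bounded_functional (\<lambda>f. f (\<phi> 0)) C" using hspace_evaluation_bounded by blast
  have mem: "comp_op \<phi> f \<in> hspace \<omega>" if f: "f \<in> hspace \<omega>" for f
  proof -
    have "pullback_energy f \<le> ennreal ((H.N f)\<^sup>2 * I)"
      using pullback_energy_le[OF f] I by (simp add: ennreal_mult)
    then have "pullback_energy f < \<infinity>" by (rule le_less_trans) simp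
    then show ?thesis using comp_op_mem_iff f by (simp add: hspace_iff)
  qed
  have bound: "H.N (comp_op \<phi> f) \<le> sqrt (C\<^sup>2 + I) * H.N f" if f: "f \<in> hspace \<omega>" for f
  proof -
    have fa: "f \<in> analytic_disk" using f by (simp add: hspace_iff)
    have "(norm (f (\<phi> 0)))\<^sup>2 \<le> (C * H.N f)\<^sup>2"
      by (rule power_mono[OF H.bounded_functionalD(3)[OF C f]]) simp
    then have "ennreal ((H.N (comp_op \<phi> f))\<^sup>2) \<le> ennreal ((C * H.N f)\<^sup>2) + ennreal ((H.N f)\<^sup>2 * I)"
      unfolding comp_op_norm[OF fa mem[OF f]] using pullback_energy_le[OF f] I
      by (intro add_mono ennreal_leI) (auto simp: ennreal_mult)
    also have "\<dots> = ennreal ((C\<^sup>2 + I) * (H.N f)\<^sup>2)"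
      using I(2) by (simp flip: ennreal_plus add: algebra_simps power_mult_distrib)
    finally have "(H.N (comp_op \<phi> f))\<^sup>2 \<le> (C\<^sup>2 + I) * (H.N f)\<^sup>2"
      using I(2) by (subst (asm) ennreal_le_iff) auto
    also have "\<dots> = (sqrt (C\<^sup>2 + I) * H.N f)\<^sup>2" using I(2) by (simp add: power_mult_distrib)
    finally show ?thesis by (rule power2_le_imp_le) (use I(2) H.N_nonneg[OF f] in simp)
  qed
  have "bounded_operator_on (hspace \<omega>) (hspace_inner \<omega>) (comp_op \<phi>)"
    unfolding bounded_operator_on_def
    using mem bound by (auto simp: comp_op_def fun_eq_iff)
  moreover obtain E where E: "orthonormal_basis_on (hspace \<omega>) (hspace_inner \<omega>) E"
    using H.orthonormal_basis_exists by blast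
  moreover have "(\<lambda>e. (H.N (comp_op \<phi> e))\<^sup>2) summable_on E"
  proof (rule nonneg_bdd_above_summable_on)
    have oE: "H.orthonormal E" by (rule H.orthonormal_basis_orthonormal[OF E])
    have EH: "E \<subseteq> hspace \<omega>" using E by (simp add: orthonormal_basis_on_def)
    have "(\<Sum>e\<in>F. (H.N (comp_op \<phi> e))\<^sup>2) \<le> C\<^sup>2 + I" if F: "finite F" "F \<subseteq> E" for F
    proof -
      have "ennreal (\<Sum>e\<in>F. (H.N (comp_op \<phi> e))\<^sup>2) = (\<Sum>e\<in>F. ennreal ((H.N (comp_op \<phi> e))\<^sup>2))"
        by (simp add: sum_ennreal)
      also have "\<dots> = (\<Sum>e\<in>F. ennreal ((norm (e (\<phi> 0)))\<^sup>2) + pullback_energy e)"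
        using F EH mem by (intro sum.cong refl comp_op_norm) (auto simp: hspace_iff subset_iff)
      also have "\<dots> = ennreal (\<Sum>e\<in>F. (norm (e (\<phi> 0)))\<^sup>2) + (\<Sum>e\<in>F. pullback_energy e)"
        by (simp add: sum.distrib sum_ennreal)
      also have "\<dots> \<le> ennreal (C\<^sup>2) + ennreal I"
        using sum_pullback_energy_le[OF E F] I(1) H.bessel_functional[OF oE F C]
        by (intro add_mono ennreal_leI) auto
      finally show ?thesis using I(2) by (simp flip: ennreal_plus)
    qed
    then show "bdd_above (sum (\<lambda>e. (H.N (comp_op \<phi> e))\<^sup>2) ` {F. F \<subseteq> E \<and> finite F})"
      by (intro bdd_aboveI[of _ "C\<^sup>2 + I"]) auto
  qed simp
  ultimately show ?thesis unfolding hilbert_schmidt_on_def by blast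
qed

text \<open>
  Here the sum over the basis has to be exchanged with the integral, which needs a countable
  index set. Summability of \<open>\<parallel>e \<circ> \<phi>\<parallel>\<^sup>2\<close> makes the set \<open>E0\<close> of basis elements with \<open>e \<circ> \<phi> \<noteq> 0\<close> countable,
  and the remaining ones contribute nothing to the integrand, since
  \<open>(e \<circ> \<phi>)' = (e' \<circ> \<phi>) \<phi>'\<close> vanishes identically for them.
\<close>

lemma kernel_energy_finite_if_hilbert_schmidt:
  assumes HS: "hilbert_schmidt_on (hspace \<omega>) (hspace_inner \<omega>) (comp_op \<phi>)"
  shows "kernel_energy < \<infinity>"
proof -
  obtain E where E: "orthonormal_basis_on (hspace \<omega>) (hspace_inner \<omega>) E"
    and summ: "(\<lambda>e. (H.N (comp_op \<phi> e))\<^sup>2) summable_on E"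
    and mem: "\<And>f. f \<in> hspace \<omega> \<Longrightarrow> comp_op \<phi> f \<in> hspace \<omega>"
    using HS unfolding hilbert_schmidt_on_def bounded_operator_on_def by blast
  have EH: "e \<in> hspace \<omega>" "e \<in> analytic_disk" if "e \<in> E" for e
    using E that by (auto simp: orthonormal_basis_on_def hspace_iff)
  define E0 where "E0 = {e\<in>E. (H.N (comp_op \<phi> e))\<^sup>2 \<noteq> 0}"
  have cE0: "countable E0" unfolding E0_def by (rule summable_countable_real[OF summ])
  have E0E: "E0 \<subseteq> E" by (auto simp: E0_def)
  define S where "S = (\<Sum>\<^sub>\<infinity>e\<in>E. (H.N (comp_op \<phi> e))\<^sup>2)"
  have vanish: "deriv e (\<phi> z) * deriv \<phi> z = 0" if "e \<in> E" "e \<notin> E0" "z \<in> \<D>" for e z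
  proof -
    have T: "comp_op \<phi> e \<in> hspace \<omega>" using mem EH that by blast
    have "H.N (comp_op \<phi> e) = 0" using that by (simp add: E0_def)
    then have "hspace_inner \<omega> (comp_op \<phi> e) (comp_op \<phi> e) = 0" using H.ip_self[OF T] by simp
    then have "comp_op \<phi> e = (\<lambda>_. 0)" using H.ip_definite[OF T] by blast
    then have "deriv_disk (comp_op \<phi> e) z = 0" by (simp add: deriv_disk_def)
    then show ?thesis using deriv_disk_comp_op[OF hol self EH(2)[OF that(1)] that(3)] by simp
  qed
  have "kernel_energy \<le> (\<integral>\<^sup>+z. \<integral>\<^sup>+e. ennreal ((norm (deriv e (\<phi> z)))\<^sup>2 * ((norm (deriv \<phi> z))\<^sup>2 * \<omega> (norm z))) \<partial>count_space E0 \<partial>area)"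
    unfolding kernel_energy_def
  proof (rule nn_integral_mono)
    fix z assume "z \<in> space area"
    then have z: "z \<in> \<D>" by simp
    then have pz: "\<phi> z \<in> \<D>" using self by blast
    define J where "J = (norm (deriv \<phi> z))\<^sup>2 * \<omega> (norm z)"
    define Q where "Q = (\<integral>\<^sup>+e. ennreal ((norm (deriv e (\<phi> z)))\<^sup>2 * J) \<partial>count_space E0)"
    have J0: "J \<ge> 0" unfolding J_def by (rule jacobian_nonneg[OF z])
    have "ennreal ((bergman_norm \<omega> (bergman_kernel \<omega> (\<phi> z)))\<^sup>2 * J) \<le> Q"
    proof (cases Q)
      case (real q)
      have hs: "((\<lambda>e. (norm (deriv e (\<phi> z)))\<^sup>2 * J) has_sum (bergman_norm \<omega> (bergman_kernel \<omega> (\<phi> z)))\<^sup>2 * J) E"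
        by (rule has_sum_cmult_left[OF basis_derivative_has_sum[OF E pz]])
      have "(bergman_norm \<omega> (bergman_kernel \<omega> (\<phi> z)))\<^sup>2 * J \<le> q"
      proof (rule has_sum_le_finite_sums[OF hs])
        fix F assume F: "finite F" "F \<subseteq> E"
        have "(\<Sum>e\<in>F. (norm (deriv e (\<phi> z)))\<^sup>2 * J) = (\<Sum>e\<in>F \<inter> E0. (norm (deriv e (\<phi> z)))\<^sup>2 * J)"
        proof (rule sum.mono_neutral_right[OF F(1)])
          show "\<forall>e\<in>F - F \<inter> E0. (norm (deriv e (\<phi> z)))\<^sup>2 * J = 0"
            using vanish[OF _ _ z] F(2) by (auto simp: J_def)
        qed auto
        moreover have "ennreal (\<Sum>e\<in>F \<inter> E0. (norm (deriv e (\<phi> z)))\<^sup>2 * J) \<le> ennreal q"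
        proof -
          have "ennreal (\<Sum>e\<in>F \<inter> E0. (norm (deriv e (\<phi> z)))\<^sup>2 * J) = (\<Sum>e\<in>F \<inter> E0. ennreal ((norm (deriv e (\<phi> z)))\<^sup>2 * J))"
            using J0 by (intro sum_ennreal[symmetric]) auto
          also have "\<dots> = (\<integral>\<^sup>+e. ennreal ((norm (deriv e (\<phi> z)))\<^sup>2 * J) * indicator (F \<inter> E0) e \<partial>count_space E0)"
            by (subst nn_integral_count_space'[of "F \<inter> E0"]) (use F in \<open>auto intro!: sum.cong\<close>)
          also have "\<dots> \<le> Q" unfolding Q_def by (intro nn_integral_mono) (auto simp: indicator_def)
          finally show ?thesis using real by simp
        qed
        ultimately show "(\<Sum>e\<in>F. (norm (deriv e (\<phi> z)))\<^sup>2 * J) \<le> q"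
          using real by simp
      qed
      then show ?thesis using real by (simp add: ennreal_leI)
    qed simp
    then show "ennreal ((bergman_norm \<omega> (bergman_kernel \<omega> (\<phi> z)))\<^sup>2 * ((norm (deriv \<phi> z))\<^sup>2 * \<omega> (norm z))) \<le>
      (\<integral>\<^sup>+e. ennreal ((norm (deriv e (\<phi> z)))\<^sup>2 * ((norm (deriv \<phi> z))\<^sup>2 * \<omega> (norm z))) \<partial>count_space E0)"
      unfolding Q_def J_def .
  qed
  also have "\<dots> = (\<integral>\<^sup>+e. pullback_energy e \<partial>count_space E0)"
    unfolding pullback_energy_def
    by (rule nn_integral_count_space_nn_integral[OF cE0]) (use pullback_integrand_measurable EH(2) E0E in blast)
  also have "\<dots> \<le> (\<integral>\<^sup>+e. ennreal ((H.N (comp_op \<phi> e))\<^sup>2) \<partial>count_space E0)"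
  proof (rule nn_integral_mono)
    fix e assume "e \<in> space (count_space E0)"
    then have "e \<in> E" using E0E by auto
    show "pullback_energy e \<le> ennreal ((H.N (comp_op \<phi> e))\<^sup>2)"
      unfolding comp_op_norm[OF EH(2)[OF \<open>e \<in> E\<close>] mem[OF EH(1)[OF \<open>e \<in> E\<close>]]] by simp
  qed
  also have "\<dots> < \<infinity>"
  proof -
    have "(\<lambda>e. (H.N (comp_op \<phi> e))\<^sup>2) summable_on E0" using summ E0E by (rule summable_on_subset_banach)
    then have "(\<lambda>e. norm ((H.N (comp_op \<phi> e))\<^sup>2)) summable_on E0" by simp
    then have "Infinite_Set_Sum.abs_summable_on (\<lambda>e. (H.N (comp_op \<phi> e))\<^sup>2) E0"
      unfolding abs_summable_equivalent .
    then have "integrable (count_space E0) (\<lambda>e. (H.N (comp_op \<phi> e))\<^sup>2)"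
      by (simp add: abs_summable_on_def)
    then show ?thesis by (simp add: integrable_iff_bounded)
  qed
  finally show ?thesis .
qed

end

end

theorem theorem4p1:
  fixes \<omega> :: "real \<Rightarrow> real" and \<phi> :: "complex \<Rightarrow> complex"
  assumes "weight \<omega>"
    and "\<phi> holomorphic_on \<D>" and "\<phi> ` \<D> \<subseteq> \<D>"
  shows "hilbert_schmidt_on (hspace \<omega>) (hspace_inner \<omega>) (comp_op \<phi>) \<longleftrightarrow>
    (\<integral>\<^sup>+z. ennreal ((bergman_norm \<omega> (bergman_kernel \<omega> z))\<^sup>2) * nevanlinna \<phi> \<omega> z \<partial>area) < \<infinity>"
  unfolding kernel_energy_eq_nevanlinna[OF assms, symmetric]
  using hilbert_schmidt_if_kernel_energy_finite[OF assms]
    kernel_energy_finite_if_hilbert_schmidt[OF assms] by blast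

end
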